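(* Let $X$ be an Asplund space and let $f: X\to(-\infty,\infty]$ be an extended-real-valued function with $\bar x\in\mathrm{int}\,\mathrm{dom}\,f$. Then the following are equivalent: (i) $f$ is locally Lipschitz continuous around $\bar x$ and $\widehat\partial f(\cdot)$ is strongly continuous at $\bar x$. (ii) $f$ is Fréchet strictly differentiable at $\bar x$.
   Context: An Asplund space is a (real) Banach space $X$ on which every continuous convex function defined on a nonempty open convex set is Fréchet differentiable on a dense subset of that set; equivalently, every separable closed subspace of $X$ has a separable dual. $X^*$ is the dual of $X$ with pairing $\langle\cdot,\cdot\rangle$. $\mathrm{dom}\,f:=\{x: f(x)<\infty\}$. $f$ is locally Lipschitz continuous around $\bar x$ if there exist $\ell\ge0$, $\delta>0$ with $|f(x)-f(w)|\le\ell\|x-w\|$ for all $x,w$ in the closed ball of radius $\delta$ centered at $\bar x$. For $x\in\mathrm{dom}\,f$, the Fréchet subdifferential is $\widehat\partial f(x):=\{x^*\in X^*: \liminf_{u\to x}\frac{f(u)-f(x)-\langle x^*,u-x\rangle}{\|u-x\|}\ge0\}$. $\widehat\partial f(\cdot)$ is strongly continuous at $\bar x$ if there exists $x^*\in X^*$ such that whenever $x_k\to\bar x$ and $x_k^*\in\widehat\partial f(x_k)$, one has $\|x_k^*-x^*\|\to0$; equivalently, there exists $x^*\in X^*$ such that for every $\varepsilon>0$ there is $\delta>0$ such that $\|u^*-x^*\|<\varepsilon$ whenever $\|x-\bar x\|<\delta$ and $u^*\in\widehat\partial f(x)$. $f$ is Fréchet strictly differentiable at $\bar x$ if there exists $v^*\in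 X^*$ with $\lim_{x,y\to\bar x,\,x\ne y}\frac{f(x)-f(y)-\langle v^*,x-y\rangle}{\|x-y\|}=0$. *)

theory Defs
  imports "HOL-Analysis.Analysis"
begin

text \<open>
  Real Banach spaces are types of class \<open>banach\<close>; the dual of \<open>'a\<close> with the operator norm is
  \<open>'a \<Rightarrow>\<^sub>L real\<close>. Differentiability in the sense of \<^const>\<open>differentiable\<close> is Frechet differentiability.
  As \<open>U\<close> is open, differentiability at a point of \<open>U\<close> depends only on the values of \<open>g\<close> on \<open>U\<close>,
  so \<open>g\<close> ranges over the functions defined on \<open>U\<close>.
\<close>

definition asplund_space :: "'a::banach itself \<Rightarrow> bool" where
  "asplund_space _ \<longleftrightarrow>
     (\<forall>(U :: 'a set) (g :: 'a \<Rightarrow> real).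
        open U \<and> convex U \<and> U \<noteq> {} \<and> convex_on U g \<and> continuous_on U g \<longrightarrow>
        U \<subseteq> closure {x \<in> U. g differentiable (at x)})"

definition eff_dom :: "('a \<Rightarrow> ereal) \<Rightarrow> 'a set" where
  "eff_dom f = {x. f x < \<infinity>}"

text \<open>
  Since \<open>\<bar>\<infinity> - \<infinity>\<bar> = \<infinity>\<close> in \<^typ>\<open>ereal\<close>, the inequality below (for \<open>x = w\<close>) forces \<open>f\<close> to be
  finite on the ball.
\<close>

definition locally_lipschitz_around :: "('a::real_normed_vector \<Rightarrow> ereal) \<Rightarrow> 'a \<Rightarrow> bool" where
  "locally_lipschitz_around f xbar \<longleftrightarrow>
     (\<exists>l::real. \<exists>\<delta>::real. l \<ge> 0 \<and> \<delta> > 0 \<and>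
        (\<forall>x\<in>cball xbar \<delta>. \<forall>w\<in>cball xbar \<delta>. \<bar>f x - f w\<bar> \<le> ereal (l * norm (x - w))))"

text \<open>
  The lower limit is over the punctured neighbourhoods of \<open>x\<close>; the set is empty for \<open>x\<close> outside
  the domain.
\<close>

definition frechet_subdiff :: "('a::real_normed_vector \<Rightarrow> ereal) \<Rightarrow> 'a \<Rightarrow> ('a \<Rightarrow>\<^sub>L real) set" where
  "frechet_subdiff f x =
     {v. x \<in> eff_dom f \<and>
         Liminf (at x) (\<lambda>u. (f u - f x - ereal (blinfun_apply v (u - x))) / ereal (norm (u - x))) \<ge> 0}"

definition strongly_continuous_at ::
    "('a::real_normed_vector \<Rightarrow> ('a \<Rightarrow>\<^sub>L real) set) \<Rightarrow> 'a \<Rightarrow> bool" where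
  "strongly_continuous_at S xbar \<longleftrightarrow>
     (\<exists>v. \<forall>(x :: nat \<Rightarrow> 'a) w.
        x \<longlonglongrightarrow> xbar \<and> (\<forall>k. w k \<in> S (x k)) \<longrightarrow> (\<lambda>k. norm (w k - v)) \<longlonglongrightarrow> 0)"

definition strictly_differentiable_at :: "('a::real_normed_vector \<Rightarrow> ereal) \<Rightarrow> 'a \<Rightarrow> bool" where
  "strictly_differentiable_at f xbar \<longleftrightarrow>
     (\<exists>v :: 'a \<Rightarrow>\<^sub>L real.
        ((\<lambda>(x, y). (f x - f y - ereal (blinfun_apply v (x - y))) / ereal (norm (x - y)))
           \<longlongrightarrow> 0) (at (xbar, xbar) within {(x, y). x \<noteq> y}))"

end

theory Submission
  imports Defs
begin

text \<open>
  The substance is that (i) implies (ii), and there a mean value inequality: if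
  \<open>g (a + e) - g a > s\<close> for a Lipschitz function \<open>g\<close> on an Asplund space, then at some
  point whose distance from \<open>a\<close> is controlled by \<open>e\<close> and \<open>s\<close> there is a Frechet subgradient
  \<open>D\<close> with \<open>D e\<close> not much smaller than \<open>s\<close>. Subgradients near \<open>xbar\<close> are close to some
  \<open>v\<close>, so \<open>g - v\<close> has arbitrarily small Lipschitz constants near \<open>xbar\<close>.

  Non-existence of a subgradient on the whole space is witnessed by finite families of vectors,
  countably many of which suffice, so one may work in a separable closed subspace \<open>Y\<close>. By a
  minimal weak* compact set argument, the dual ball is separable for the norm of the dual of
  \<open>Y\<close>. If \<open>z j\<close> is dense in it, then \<open>\<Sum>j. 2^(-j) \<parallel>\<phi> - z j\<parallel>\<^sup>2\<close> is a rotund function of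
  \<open>\<phi>\<close>, and its conjugate is Frechet smooth along \<open>Y\<close>. This provides smooth bumps, a smooth
  variational principle, and a smooth penalty with which the mean value inequality is proved by
  minimisation.
\<close>

subsection \<open>Sublinear functionals and the dual ball\<close>

text \<open>Two facts shape the proof. The definition of an Asplund space gives access to
  functionals only by differentiating convex functions, so functionals on the whole space are
  obtained as derivatives of sublinear or support functions. And Frechet smooth penalties are
  constructed only along a separable subspace \<open>Y\<close>, whereas a subgradient of
  \<open>f\<close> is tested in all directions. Hence existence of a subgradient on the whole space
  is turned into a condition that can be checked from inside \<open>Y\<close>: nonnegativity of all
  finite combinations of the inequalities that define it. Rotundity enters as follows. A
  near-maximiser of \<open>\<phi> x - N \<phi>\<close>, with \<open>N\<close> the weight, has almost
  the same distance to each \<open>z j\<close> as the exact maximiser; taking a \<open>z j\<close>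
  next to that maximiser shows that the two are close in norm. Finally \<open>f\<close> is Lipschitz
  only near \<open>xbar\<close> and may be infinite elsewhere. Frechet subgradients being local, it
  is replaced by a globally Lipschitz real function.\<close>

lemma has_derivative_le_slope:
  fixes f :: "'a::real_normed_vector \<Rightarrow> real"
  assumes f: "(f has_derivative D) (at x within S)" and "\<tau> > 0"
    and slope: "\<And>t. 0 < t \<Longrightarrow> t < \<tau> \<Longrightarrow> x + t *\<^sub>R h \<in> S \<and> f (x + t *\<^sub>R h) - f x \<le> t * c"
  shows "D h \<le> c"
proof (rule field_le_epsilon)
  fix e :: real assume "e > 0"
  have lin: "bounded_linear D" using f by (rule has_derivative_bounded_linear)
  define e' where "e' = e / (norm h + 1)"
  have "e' > 0" using \<open>e > 0\<close> by (simp add: e'_def add_nonneg_pos)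
  then obtain d where d: "d > 0"
    "\<And>y. y \<in> S \<Longrightarrow> norm (y - x) < d \<Longrightarrow> norm (f y - f x - D (y - x)) \<le> e' * norm (y - x)"
    using f unfolding has_derivative_within_alt by blast
  define t where "t = min (\<tau> / 2) (d / 2 / (norm h + 1))"
  have t: "0 < t" "t < \<tau>" using d \<open>\<tau> > 0\<close> by (auto simp: t_def add_nonneg_pos)
  have "t * norm h \<le> d / 2 / (norm h + 1) * (norm h + 1)"
    using t d by (intro mult_mono) (auto simp: t_def)
  also have "\<dots> = d / 2"
    using add_nonneg_pos[OF norm_ge_zero[of h] zero_less_one] by (subst nonzero_eq_divide_eq[symmetric]) auto
  also have "\<dots> < d" using d by simp
  finally have "norm (x + t *\<^sub>R h - x) < d" using t by simp
  with d(2)[of "x + t *\<^sub>R h"] slope[OF t] t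
  have "\<bar>f (x + t *\<^sub>R h) - f x - D (t *\<^sub>R h)\<bar> \<le> e' * (t * norm h)" by simp
  with slope[OF t] have "D (t *\<^sub>R h) \<le> t * c + e' * (t * norm h)" by linarith
  then have "t * D h \<le> t * (c + e' * norm h)"
    using linear_scale[OF bounded_linear.linear[OF lin]] by (simp add: algebra_simps)
  then have "D h \<le> c + e' * norm h" using t by simp
  also have "e' * norm h \<le> e" using \<open>e > 0\<close> by (simp add: e'_def divide_simps add_nonneg_pos)
  finally show "D h \<le> c + e" by simp
qed

lemma asplund_differentiable_point:
  fixes p :: "'a::banach \<Rightarrow> real"
  assumes "asplund_space TYPE('a)" "convex_on UNIV p" "continuous_on UNIV p" "open U" "U \<noteq> {}"
  obtains x where "x \<in> U" "p differentiable (at x)"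
proof -
  have "UNIV \<subseteq> closure {x \<in> UNIV. p differentiable (at x)}"
    using assms(1-3) unfolding asplund_space_def by (metis convex_UNIV open_UNIV UNIV_not_empty)
  then show ?thesis
    using assms(4,5) that by (auto simp: closure_iff_nhds_not_empty) (metis (no_types, lifting) UNIV_I
      all_not_in_conv closure_iff_nhds_not_empty disjoint_iff mem_Collect_eq subset_refl subsetD)
qed

text \<open>In an Asplund space this replaces the Hahn-Banach theorem: the derivative of a sublinear
  functional at any point of differentiability is a linear minorant.\<close>

lemma asplund_linear_minorant:
  fixes p :: "'a::banach \<Rightarrow> real"
  assumes "asplund_space TYPE('a)" "open U" "U \<noteq> {}"
    and add: "\<And>x y. p (x + y) \<le> p x + p y"
    and scale: "\<And>t x. t > 0 \<Longrightarrow> p (t *\<^sub>R x) = t * p x"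
    and bound: "\<And>x. p x \<le> c * norm x"
  obtains x D where "x \<in> U" "bounded_linear D" "\<And>h. D h \<le> p h" "D x = p x"
proof -
  have p0: "p 0 = 0" using scale[of 2 0] by simp
  have "convex_on UNIV p"
  proof (rule convex_onI)
    fix t :: real and x y :: 'a assume "0 < t" "t < 1"
    then show "p ((1 - t) *\<^sub>R x + t *\<^sub>R y) \<le> (1 - t) * p x + t * p y"
      using add[of "(1 - t) *\<^sub>R x" "t *\<^sub>R y"] by (simp add: scale)
  qed auto
  moreover have "continuous_on UNIV p"
  proof -
    have le: "p x - p y \<le> c * norm (x - y)" for x y
      using add[of "x - y" y] bound[of "x - y"] by simp
    have "\<bar>p x - p y\<bar> \<le> \<bar>c\<bar> * norm (x - y)" for x y
    proof -
      have "c * norm (x - y) \<le> \<bar>c\<bar> * norm (x - y)" by (intro mult_right_mono) auto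
      then show ?thesis using le[of x y] le[of y x] by (simp add: norm_minus_commute)
    qed
    then have "\<bar>c\<bar>-lipschitz_on UNIV p" by (intro lipschitz_onI) (auto simp: dist_norm)
    then show ?thesis by (rule lipschitz_on_continuous_on)
  qed
  ultimately obtain x where x: "x \<in> U" "p differentiable (at x)"
    using asplund_differentiable_point assms(1-3) by blast
  then obtain D where D: "(p has_derivative D) (at x)" unfolding differentiable_def by blast
  have le: "D h \<le> p h" for h
  proof (rule has_derivative_le_slope[OF D, of 1])
    fix t :: real assume "0 < t"
    then show "x + t *\<^sub>R h \<in> UNIV \<and> p (x + t *\<^sub>R h) - p x \<le> t * p h"
      using add[of x "t *\<^sub>R h"] scale[of t h] by simp
  qed simp
  \<comment> \<open>On the ray from \<open>x\<close> towards 0 the function \<open>p\<close> is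
    linear by homogeneity, with slope exactly \<open>- p x\<close>. Together with
    \<open>D x \<le> p x\<close> this makes \<open>D\<close> touch \<open>p\<close> at
    \<open>x\<close>.\<close>
  have "D (- x) \<le> - p x"
  proof (rule has_derivative_le_slope[OF D, of 1])
    fix t :: real assume "0 < t" "t < 1"
    then show "x + t *\<^sub>R - x \<in> UNIV \<and> p (x + t *\<^sub>R - x) - p x \<le> t * - p x"
      using scale[of "1 - t" x] by (simp add: algebra_simps)
  qed simp
  moreover have lin: "bounded_linear D" using D by (rule has_derivative_bounded_linear)
  ultimately have "D x = p x"
    using le[of x] linear_neg[OF bounded_linear.linear[OF lin], of x] by simp
  with that x le lin show ?thesis by blast
qed

text \<open>Functionals are kept as plain functions: the product topology on
  \<open>'a \<Rightarrow> real\<close> is pointwise convergence, so the weak* topology of the dual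
  ball comes for free.\<close>

definition dual_ball :: "('a::real_normed_vector \<Rightarrow> real) set" where
  "dual_ball = {\<phi>. linear \<phi> \<and> (\<forall>x. \<bar>\<phi> x\<bar> \<le> norm x)}"

lemma dual_ballD: "\<phi> \<in> dual_ball \<Longrightarrow> linear \<phi>" "\<phi> \<in> dual_ball \<Longrightarrow> \<bar>\<phi> x\<bar> \<le> norm x"
  by (auto simp: dual_ball_def)

lemma dual_ball_ops:
  assumes "\<phi> \<in> dual_ball"
  shows "\<phi> (x + y) = \<phi> x + \<phi> y" "\<phi> (x - y) = \<phi> x - \<phi> y" "\<phi> (t *\<^sub>R x) = t * \<phi> x" "\<phi> 0 = 0"
    "\<phi> (- x) = - \<phi> x"
  using dual_ballD(1)[OF assms]
  by (simp_all add: linear_add linear_diff linear_scale linear_0 linear_neg)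

lemma dual_ball_bounded_linear: "\<phi> \<in> dual_ball \<Longrightarrow> bounded_linear \<phi>"
  by (rule bounded_linear_intro[where K = 1]) (auto simp: dual_ball_ops dual_ballD)

lemma zero_in_dual_ball: "(\<lambda>x. 0) \<in> dual_ball"
  by (auto simp: dual_ball_def intro: linear_zero)

lemma continuous_on_eval: "continuous_on A (\<lambda>\<phi>::'a \<Rightarrow> real. \<phi> x)"
  by (rule continuous_on_subset[OF continuous_on_product_coordinates]) simp

text \<open>Banach-Alaoglu: linearity is a family of closed conditions on a Tychonoff product of
  intervals.\<close>

lemma compact_dual_ball: "compact (dual_ball :: ('a::real_normed_vector \<Rightarrow> real) set)"
proof -
  let ?P = "PiE UNIV (\<lambda>x::'a. {- norm x .. norm x})"
  have "compactin (product_topology (\<lambda>i. euclidean) UNIV) ?P"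
    by (auto simp: compactin_PiE)
  then have P: "compact ?P" by (simp add: euclidean_product_topology)
  have eq: "dual_ball = ?P \<inter>
      ((\<Inter>x. \<Inter>y. {\<phi>. \<phi> (x + y) = \<phi> x + \<phi> y}) \<inter> (\<Inter>t. \<Inter>x. {\<phi>. \<phi> (t *\<^sub>R x) = t * \<phi> x}))"
    by (auto simp: dual_ball_def linear_iff abs_le_iff minus_le_iff)
  have "closed ((\<Inter>x. \<Inter>y. {\<phi>::'a\<Rightarrow>real. \<phi> (x + y) = \<phi> x + \<phi> y}) \<inter> (\<Inter>t. \<Inter>x. {\<phi>. \<phi> (t *\<^sub>R x) = t * \<phi> x}))"
    by (intro closed_Int closed_INT ballI closed_Collect_eq continuous_intros continuous_on_eval)
  with P show ?thesis unfolding eq by (rule compact_Int_closed)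
qed

text \<open>The norm need not be differentiable at \<open>x\<close>, only at some \<open>y\<close>
  within \<open>\<eta> / 2\<close>. The derivative there attains \<open>norm y\<close>, and
  returning to \<open>x\<close> costs \<open>\<eta> / 2\<close> twice.\<close>

lemma asplund_norming:
  fixes x :: "'a::banach"
  assumes "asplund_space TYPE('a)" "\<eta> > 0"
  obtains \<phi> where "\<phi> \<in> dual_ball" "\<phi> x \<ge> norm x - \<eta>"
proof -
  obtain y D where D: "y \<in> ball x (\<eta> / 2)" "bounded_linear D" "\<And>h. D h \<le> norm h" "D y = norm y"
    using asplund_linear_minorant[OF assms(1) open_ball, of x "\<eta> / 2" norm 1] \<open>\<eta> > 0\<close>
    by (auto simp: norm_triangle_ineq)
  have lin: "linear D" using D(2) by (rule bounded_linear.linear)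
  have "\<bar>D h\<bar> \<le> norm h" for h
    using D(3)[of h] D(3)[of "- h"] linear_neg[OF lin, of h] by auto
  with lin have mem: "D \<in> dual_ball" by (simp add: dual_ball_def)
  have "norm (x - y) < \<eta> / 2" using D(1) by (simp add: dist_norm)
  moreover have "\<bar>D (x - y)\<bar> \<le> norm (x - y)" using mem by (rule dual_ballD)
  moreover have "norm x \<le> norm y + norm (x - y)" by (metis diff_add_cancel add.commute norm_triangle_ineq)
  ultimately have "D x \<ge> norm x - \<eta>"
    using D(4) linear_diff[OF lin, of x y] by linarith
  with mem that show ?thesis by blast
qed

subsection \<open>Separability of the dual ball over a separable subspace\<close>

text \<open>Let \<open>x\<close> be a point of differentiability of the support function
  \<open>p\<close> of \<open>A\<close>. A member of \<open>A\<close> lies below \<open>p\<close>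
  everywhere, and if it almost attains \<open>p x\<close>, this forces it to be norm close to the
  derivative of \<open>p\<close> at \<open>x\<close>.\<close>

lemma asplund_dentable:
  fixes A :: "('a::banach \<Rightarrow> real) set"
  assumes "asplund_space TYPE('a)" "A \<subseteq> dual_ball" "A \<noteq> {}" "\<epsilon> > 0"
  obtains x c where "\<exists>\<phi>\<in>A. \<phi> x > c"
    "\<And>\<phi> \<psi> y. \<phi> \<in> A \<Longrightarrow> \<psi> \<in> A \<Longrightarrow> \<phi> x > c \<Longrightarrow> \<psi> x > c \<Longrightarrow> \<bar>\<phi> y - \<psi> y\<bar> \<le> \<epsilon> * norm y"
proof -
  define p where "p = (\<lambda>x. SUP \<phi>\<in>A. \<phi> x)"
  have ball: "\<phi> \<in> dual_ball" if "\<phi> \<in> A" for \<phi> using that assms(2) by blast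
  have bdd: "bdd_above ((\<lambda>\<phi>. \<phi> x) ` A)" for x
    using dual_ballD(2)[OF ball] by (intro bdd_aboveI[where M = "norm x"]) (auto simp: abs_le_iff)
  have upper: "\<phi> x \<le> p x" if "\<phi> \<in> A" for \<phi> x
    unfolding p_def using bdd that by (rule cSUP_upper[rotated])
  have least: "p x \<le> c" if "\<And>\<phi>. \<phi> \<in> A \<Longrightarrow> \<phi> x \<le> c" for x c
    unfolding p_def using assms(3) that by (rule cSUP_least)
  have "convex_on UNIV p"
  proof (rule convex_onI)
    fix t :: real and x y :: 'a assume t: "0 < t" "t < 1"
    show "p ((1 - t) *\<^sub>R x + t *\<^sub>R y) \<le> (1 - t) * p x + t * p y"
    proof (rule least)
      fix \<phi> assume "\<phi> \<in> A"
      then show "\<phi> ((1 - t) *\<^sub>R x + t *\<^sub>R y) \<le> (1 - t) * p x + t * p y"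
        using t upper[of \<phi> x] upper[of \<phi> y] by (simp add: dual_ball_ops[OF ball] add_mono)
    qed
  qed auto
  moreover have "continuous_on UNIV p"
  proof -
    have le: "p x \<le> p y + norm (x - y)" for x y
    proof (rule least)
      fix \<phi> assume "\<phi> \<in> A"
      then show "\<phi> x \<le> p y + norm (x - y)"
        using upper[of \<phi> y] dual_ballD(2)[OF ball, of \<phi> "x - y"] by (simp add: dual_ball_ops[OF ball])
    qed
    have "1-lipschitz_on UNIV p"
    proof (rule lipschitz_onI)
      show "dist (p x) (p y) \<le> 1 * dist x y" for x y
        using le[of x y] le[of y x] by (simp add: dist_norm abs_le_iff norm_minus_commute)
    qed simp
    then show ?thesis by (rule lipschitz_on_continuous_on)
  qed
  ultimately obtain x where "p differentiable (at x)"
    using asplund_differentiable_point[OF assms(1) _ _ open_UNIV UNIV_not_empty] by blast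
  then obtain D where D: "(p has_derivative D) (at x)" unfolding differentiable_def by blast
  have lin: "linear D" using has_derivative_bounded_linear[OF D] by (rule bounded_linear.linear)
  define e where "e = \<epsilon> / 4"
  have "e > 0" using assms(4) by (simp add: e_def)
  then obtain d where d: "d > 0"
    "\<And>y. norm (y - x) < d \<Longrightarrow> norm (p y - p x - D (y - x)) \<le> e * norm (y - x)"
    using D unfolding has_derivative_at_alt by blast
  \<comment> \<open>The depth of the slice equals the differentiation error at distance
    \<open>d / 2\<close>. The two errors add up to \<open>2 * e * (d / 2)\<close>, so each member of
    the slice is within \<open>2 * e\<close>, half of \<epsilon>, of \<open>D\<close>.\<close>
  define c where "c = p x - e * (d / 2)"
  have near: "\<phi> y - D y \<le> 2 * e * norm y" if \<phi>: "\<phi> \<in> A" "\<phi> x > c" for \<phi> y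
  proof (cases "y = 0")
    case True
    then show ?thesis using \<phi> lin by (simp add: dual_ball_ops[OF ball] linear_0)
  next
    case False
    define h where "h = (d / 2 / norm y) *\<^sub>R y"
    have h: "norm h = d / 2" using False d by (simp add: h_def)
    have "norm (p (x + h) - p x - D h) \<le> e * (d / 2)"
      using d(2)[of "x + h"] d(1) h by simp
    moreover have "\<phi> x + \<phi> h \<le> p (x + h)"
      using upper[OF \<phi>(1), of "x + h"] by (simp add: dual_ball_ops[OF ball[OF \<phi>(1)]])
    ultimately have "\<phi> h - D h \<le> 2 * e * (d / 2)" using \<phi>(2) unfolding c_def real_norm_def by linarith
    then have "(d / 2 / norm y) * (\<phi> y - D y) \<le> 2 * e * (d / 2)"
      using \<phi>(1) lin unfolding h_def by (simp add: dual_ball_ops[OF ball] linear_scale right_diff_distrib)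
    then have "d * \<phi> y \<le> d * (D y + 2 * e * norm y)" using False by (simp add: field_simps)
    then show ?thesis using d(1) by simp
  qed
  have abs_near: "\<bar>\<phi> y - D y\<bar> \<le> 2 * e * norm y" if \<phi>: "\<phi> \<in> A" "\<phi> x > c" for \<phi> y
    using near[OF \<phi>, of y] near[OF \<phi>, of "- y"] \<phi>(1) lin
    by (simp add: dual_ball_ops[OF ball] linear_neg)
  show ?thesis
  proof (rule that)
    have "c < p x" using \<open>e > 0\<close> d(1) by (simp add: c_def)
    then show "\<exists>\<phi>\<in>A. \<phi> x > c"
      unfolding p_def using less_cSUP_iff[OF assms(3) bdd] by blast
    show "\<bar>\<phi> y - \<psi> y\<bar> \<le> \<epsilon> * norm y"
      if "\<phi> \<in> A" "\<psi> \<in> A" "\<phi> x > c" "\<psi> x > c" for \<phi> \<psi> y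
    proof -
      have "2 * e * norm y = \<epsilon> * norm y / 2" by (simp add: e_def)
      then show ?thesis using abs_near[of \<phi> y] abs_near[of \<psi> y] that by linarith
    qed
  qed
qed

lemma closed_le_eval: "closed {\<phi>::'a \<Rightarrow> real. \<phi> x \<le> c}"
  by (intro closed_Collect_le continuous_on_eval continuous_intros)

text \<open>Zorn's lemma is applied to the complements, so that chains are bounded by unions. The
  union of a chain keeps the image because the fibre of \<open>r\<close> over each \<open>y\<close>,
  cut with \<open>K\<close>, is compact and meets the complement of every member of the
  chain.\<close>

lemma minimal_closed_with_same_image:
  fixes r :: "'a::topological_space \<Rightarrow> 'b::t2_space"
  assumes "compact K" "continuous_on UNIV r" "closed L" "K \<inter> L \<noteq> {}"
  obtains M where "closed M" "r ` (K \<inter> M) = r ` (K \<inter> L)"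
    "\<And>M'. closed M' \<Longrightarrow> M' \<subseteq> M \<Longrightarrow> r ` (K \<inter> M') = r ` (K \<inter> L) \<Longrightarrow> M' = M"
proof -
  define F where "F = {U. open U \<and> r ` (K - U) = r ` (K \<inter> L)}"
  have "\<exists>M\<in>F. \<forall>U\<in>F. M \<subseteq> U \<longrightarrow> U = M"
  proof (rule subset_Zorn_nonempty)
    have "- L \<in> F" using \<open>closed L\<close> by (simp add: F_def Diff_eq open_Compl)
    then show "F \<noteq> {}" by blast
  next
    fix \<C> assume C: "\<C> \<noteq> {}" "subset.chain F \<C>"
    then have sub: "\<And>U. U \<in> \<C> \<Longrightarrow> open U \<and> r ` (K - U) = r ` (K \<inter> L)"
      by (auto simp: F_def subset.chain_def)
    have "r ` (K \<inter> L) \<subseteq> r ` (K - \<Union>\<C>)"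
    proof
      fix y assume y: "y \<in> r ` (K \<inter> L)"
      have cl: "closed (r -` {y})"
        using assms(2) by (intro closed_vimage) auto
      have "(K \<inter> r -` {y}) \<inter> (\<Inter>U\<in>\<C>. - U) \<noteq> {}"
      proof (rule compact_imp_fip_image)
        show "compact (K \<inter> r -` {y})" using assms(1) cl by (rule compact_Int_closed)
        show "closed (- U)" if "U \<in> \<C>" for U using sub[OF that] by (simp add: closed_Compl)
        fix I' assume I: "finite I'" "I' \<subseteq> \<C>"
        show "K \<inter> r -` {y} \<inter> (\<Inter>U\<in>I'. - U) \<noteq> {}"
        proof (cases "I' = {}")
          case True
          then show ?thesis using y by auto
        next
          case False
          have "\<Union>I' \<in> I'"
          proof (rule Union_in_chain[OF I(1) False])
            show "subset.chain F I'" using C(2) I(2) unfolding subset.chain_def by (meson subset_iff)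
          qed
          then have "y \<in> r ` (K - \<Union>I')" using sub I(2) y by blast
          then show ?thesis by auto
        qed
      qed
      then show "y \<in> r ` (K - \<Union>\<C>)" by auto
    qed
    moreover have "r ` (K - \<Union>\<C>) \<subseteq> r ` (K \<inter> L)"
    proof -
      obtain U where "U \<in> \<C>" using C(1) by blast
      then show ?thesis using sub[of U] by blast
    qed
    ultimately show "\<Union>\<C> \<in> F" using sub by (auto simp: F_def intro!: open_Union)
  qed
  then obtain U where U: "U \<in> F" "\<And>V. V \<in> F \<Longrightarrow> U \<subseteq> V \<Longrightarrow> V = U" by blast
  show ?thesis
  proof (rule that[of "- U"])
    show "closed (- U)" "r ` (K \<inter> - U) = r ` (K \<inter> L)" using U(1) by (auto simp: F_def Diff_eq)
    fix M' assume "closed M'" "M' \<subseteq> - U" "r ` (K \<inter> M') = r ` (K \<inter> L)"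
    then have "- M' \<in> F" "U \<subseteq> - M'" by (auto simp: F_def Diff_eq open_Compl)
    then show "M' = - U" using U(2)[of "- M'"] by auto
  qed
qed

text \<open>As in Cantor-Bendixson: discarding the points that have a basic neighbourhood with
  countable trace removes only countably many points, so every surviving trace stays
  uncountable.\<close>

lemma uncountable_condensation:
  fixes r :: "'a \<Rightarrow> 'b::second_countable_topology"
  assumes "uncountable A"
  obtains A' where "A' \<subseteq> A" "uncountable A'"
    "\<And>V a. open V \<Longrightarrow> a \<in> A' \<Longrightarrow> r a \<in> V \<Longrightarrow> uncountable {b \<in> A'. r b \<in> V}"
proof -
  obtain \<B> :: "'b set set" where B: "countable \<B>" "topological_basis \<B>" using ex_countable_basis by blast
  define N where "N = (\<Union>U\<in>{U\<in>\<B>. countable {b \<in> A. r b \<in> U}}. {b \<in> A. r b \<in> U})"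
  have N: "countable N" unfolding N_def using B(1) by (intro countable_UN) auto
  show ?thesis
  proof (rule that[of "A - N"])
    show "uncountable (A - N)" using assms N by (rule uncountable_minus_countable)
    fix V a assume V: "open V" "a \<in> A - N" "r a \<in> V"
    obtain U where U: "U \<in> \<B>" "r a \<in> U" "U \<subseteq> V"
      using topological_basisE[OF B(2) V(1,3)] by metis
    then have "uncountable {b \<in> A. r b \<in> U}" using V(2) by (auto simp: N_def)
    then have "uncountable ({b \<in> A. r b \<in> U} - N)" using N by (rule uncountable_minus_countable)
    then show "uncountable {b \<in> A - N. r b \<in> V}"
      by (rule contrapos_nn) (rule countable_subset[rotated], use U(3) in auto)
  qed auto
qed

text \<open>The set \<open>A\<close> is lifted to a minimal closed set with the same restriction to \<open>range c\<close>. A slice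
  of this minimal set that is small in norm contains all lifts of some nonempty relatively open
  part of the restriction.\<close>

lemma asplund_separated_countable:
  fixes c :: "nat \<Rightarrow> 'a::banach"
  assumes "asplund_space TYPE('a)" "A \<subseteq> dual_ball" "\<epsilon> > 0"
    and sep: "\<And>\<phi> \<psi>. \<phi> \<in> A \<Longrightarrow> \<psi> \<in> A \<Longrightarrow> \<phi> \<noteq> \<psi> \<Longrightarrow> \<exists>n. \<bar>\<phi> (c n) - \<psi> (c n)\<bar> > \<epsilon> * norm (c n)"
  shows "countable A"
proof (rule ccontr)
  assume "uncountable A"
  define r :: "('a \<Rightarrow> real) \<Rightarrow> nat \<Rightarrow> real" where "r = (\<lambda>\<phi> n. \<phi> (c n))"
  have r: "continuous_on UNIV r"
    unfolding r_def by (intro continuous_on_coordinatewise_then_product continuous_on_eval)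
  obtain A' where A': "A' \<subseteq> A" "uncountable A'"
    "\<And>V a. open V \<Longrightarrow> a \<in> A' \<Longrightarrow> r a \<in> V \<Longrightarrow> uncountable {b \<in> A'. r b \<in> V}"
    using uncountable_condensation[OF \<open>uncountable A\<close>, of r] by blast
  define L where "L = closure A'"
  have sub: "A' \<subseteq> dual_ball \<inter> L" using A'(1) assms(2) closure_subset by (auto simp: L_def)
  have "A' \<noteq> {}" using A'(2) by auto
  with sub have "dual_ball \<inter> L \<noteq> {}" by blast
  then obtain M where M: "closed M" "r ` (dual_ball \<inter> M) = r ` (dual_ball \<inter> L)"
    "\<And>M'. closed M' \<Longrightarrow> M' \<subseteq> M \<Longrightarrow> r ` (dual_ball \<inter> M') = r ` (dual_ball \<inter> L) \<Longrightarrow> M' = M"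
    using minimal_closed_with_same_image[OF compact_dual_ball r, of L] by (auto simp: L_def)
  then have "dual_ball \<inter> M \<noteq> {}" using \<open>dual_ball \<inter> L \<noteq> {}\<close> by auto
  then obtain x s where x: "\<exists>\<phi>\<in>dual_ball \<inter> M. \<phi> x > s"
    "\<And>\<phi> \<psi> y. \<phi> \<in> dual_ball \<inter> M \<Longrightarrow> \<psi> \<in> dual_ball \<inter> M \<Longrightarrow> \<phi> x > s \<Longrightarrow> \<psi> x > s \<Longrightarrow>
       \<bar>\<phi> y - \<psi> y\<bar> \<le> \<epsilon> * norm y"
    using asplund_dentable[OF assms(1) _ _ assms(3), of "dual_ball \<inter> M"] by (metis inf_le1)
  \<comment> \<open>By minimality, cutting the slice out of \<open>M\<close> loses a point of the
    image. The image of the rest is compact, so an open set \<open>V\<close> around that point is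
    lost: everything in \<open>dual_ball \<inter> M\<close> that \<open>r\<close> maps into
    \<open>V\<close> belongs to the slice.\<close>
  define M' where "M' = M \<inter> {\<phi>. \<phi> x \<le> s}"
  have M': "closed M'" unfolding M'_def by (intro closed_Int M(1) closed_le_eval)
  have "M' \<noteq> M" using x(1) unfolding M'_def by force
  then have ne: "r ` (dual_ball \<inter> M') \<noteq> r ` (dual_ball \<inter> L)" using M(3)[OF M'] by (auto simp: M'_def)
  moreover have "r ` (dual_ball \<inter> M') \<subseteq> r ` (dual_ball \<inter> L)" unfolding M(2)[symmetric] by (auto simp: M'_def)
  ultimately obtain \<phi> where \<phi>: "\<phi> \<in> dual_ball \<inter> L" "r \<phi> \<notin> r ` (dual_ball \<inter> M')" by blast
  define V where "V = - r ` (dual_ball \<inter> M')"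
  have "compact (r ` (dual_ball \<inter> M'))"
    using continuous_on_subset[OF r] compact_dual_ball M' by (intro compact_continuous_image) (auto intro: compact_Int_closed)
  then have V: "open V" unfolding V_def by (intro open_Compl compact_imp_closed)
  have "open (r -` V)" using r V by (simp add: continuous_on_eq_continuous_at open_vimage)
  moreover have "\<phi> \<in> r -` V" using \<phi>(2) by (simp add: V_def)
  ultimately obtain a where a: "a \<in> A'" "r a \<in> V"
    using \<phi>(1) unfolding L_def by (metis IntD2 closure_iff_nhds_not_empty disjoint_iff subset_refl vimageE)
  define W where "W = {b \<in> A'. r b \<in> V}"
  have W: "uncountable W" unfolding W_def using A'(3)[OF V a] .
  then obtain a1 where a1: "a1 \<in> W" by (metis countable_empty ex_in_conv)
  \<comment> \<open>Condensation provides a second member of \<open>A'\<close> over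
    \<open>V\<close>. The lifts of both lie in the slice, so the two are \<epsilon>-close on
    \<open>range c\<close>, against \<open>sep\<close>.\<close>
  have "uncountable (W - {a1})" using W by (simp add: countable_Diff_eq)
  then obtain a2 where a2: "a2 \<in> W" "a2 \<noteq> a1" by (metis countable_empty ex_in_conv Diff_iff singletonI)
  have lift: "\<exists>\<psi>\<in>dual_ball \<inter> M. \<psi> x > s \<and> r \<psi> = r b" if "b \<in> W" for b
  proof -
    have b: "b \<in> A'" "r b \<in> V" using that by (auto simp: W_def)
    then have "r b \<in> r ` (dual_ball \<inter> M)" unfolding M(2) using sub by blast
    then obtain \<psi> where \<psi>: "\<psi> \<in> dual_ball \<inter> M" "r \<psi> = r b" by auto
    with b(2) have "\<psi> \<notin> M'" by (metis ComplD IntD1 IntI V_def imageI)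
    with \<psi> show ?thesis by (auto simp: M'_def not_le)
  qed
  obtain p1 p2 where p: "p1 \<in> dual_ball \<inter> M" "p1 x > s" "r p1 = r a1"
    "p2 \<in> dual_ball \<inter> M" "p2 x > s" "r p2 = r a2"
    using lift[OF a1] lift[OF a2(1)] by blast
  have "\<bar>a1 (c n) - a2 (c n)\<bar> \<le> \<epsilon> * norm (c n)" for n
    using x(2)[OF p(1,4,2,5), of "c n"] p(3,6) by (simp add: r_def fun_eq_iff)
  moreover have "a1 \<in> A" "a2 \<in> A" using a1 a2 A'(1) by (auto simp: W_def)
  ultimately show False using sep[of a1 a2] a2(2) by (auto simp: not_le[symmetric])
qed

text \<open>By Zorn. A maximal family of pairwise \<epsilon>-separated functionals is an
  \<epsilon>-net, which is how separability is derived.\<close>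

lemma maximal_separated:
  assumes sym: "\<And>x y. R x y \<Longrightarrow> R y x"
  obtains M where "M \<subseteq> B" "\<And>x y. x \<in> M \<Longrightarrow> y \<in> M \<Longrightarrow> x \<noteq> y \<Longrightarrow> R x y"
    "\<And>x. x \<in> B \<Longrightarrow> x \<in> M \<or> (\<exists>y\<in>M. \<not> (R x y))"
proof -
  define F where "F = {A. A \<subseteq> B \<and> (\<forall>x\<in>A. \<forall>y\<in>A. x \<noteq> y \<longrightarrow> R x y)}"
  have "\<exists>M\<in>F. \<forall>X\<in>F. M \<subseteq> X \<longrightarrow> X = M"
  proof (rule subset_Zorn_nonempty)
    have "{} \<in> F" by (simp add: F_def)
    then show "F \<noteq> {}" by blast
    fix C assume C: "subset.chain F C"
    show "\<Union>C \<in> F"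
      unfolding F_def
    proof (intro CollectI conjI ballI impI)
      show "\<Union>C \<subseteq> B" using C by (auto simp: F_def subset.chain_def)
      fix x y assume "x \<in> \<Union>C" "y \<in> \<Union>C" "x \<noteq> y"
      then obtain X Y where XY: "X \<in> C" "Y \<in> C" "x \<in> X" "y \<in> Y" by blast
      then have "X \<subseteq> Y \<or> Y \<subseteq> X" "X \<in> F" "Y \<in> F" using C by (auto simp: subset.chain_def)
      then show "R x y" using XY \<open>x \<noteq> y\<close> by (auto simp: F_def)
    qed
  qed
  then obtain M where M: "M \<in> F" "\<And>X. X \<in> F \<Longrightarrow> M \<subseteq> X \<Longrightarrow> X = M" by blast
  show ?thesis
  proof (rule that[of M])
    show "R x y" if "x \<in> M" "y \<in> M" "x \<noteq> y" for x y
      using M(1) that by (auto simp: F_def)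
    show "M \<subseteq> B" using M(1) by (auto simp: F_def)
    fix x assume x: "x \<in> B"
    show "x \<in> M \<or> (\<exists>y\<in>M. \<not> (R x y))"
    proof (rule ccontr)
      assume *: "\<not> ?thesis"
      then have "insert x M \<in> F" using M(1) x sym by (auto simp: F_def)
      then have "insert x M = M" using M(2) by blast
      then show False using * by blast
    qed
  qed
qed

text \<open>Maximal separated families are countable nets for each accuracy
  \<open>1 / (m + 1)\<close>, and their union is dense. Estimates on \<open>range c\<close> pass to
  its closure because both sides are continuous.\<close>

lemma asplund_dual_ball_separable:
  fixes c :: "nat \<Rightarrow> 'a::banach"
  assumes "asplund_space TYPE('a)"
  obtains z :: "nat \<Rightarrow> 'a \<Rightarrow> real" where "range z \<subseteq> dual_ball"
    "\<And>\<phi> \<epsilon>. \<phi> \<in> dual_ball \<Longrightarrow> \<epsilon> > 0 \<Longrightarrow>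
       \<exists>j. \<forall>y\<in>closure (range c). \<bar>\<phi> y - z j y\<bar> \<le> \<epsilon> * norm y"
proof -
  have "\<exists>M. M \<subseteq> dual_ball \<and> countable M \<and>
      (\<forall>\<phi>\<in>dual_ball. \<exists>\<psi>\<in>M. \<forall>n. \<bar>\<phi> (c n) - \<psi> (c n)\<bar> \<le> \<epsilon> * norm (c n))"
    if "\<epsilon> > 0" for \<epsilon> :: real
  proof -
    define R where "R = (\<lambda>(\<phi> :: 'a \<Rightarrow> real) \<psi>. \<exists>n. \<bar>\<phi> (c n) - \<psi> (c n)\<bar> > \<epsilon> * norm (c n))"
    have sym: "R \<psi> \<phi>" if "R \<phi> \<psi>" for \<phi> \<psi>
      using that unfolding R_def by (simp add: abs_minus_commute)
    obtain M where M: "M \<subseteq> dual_ball" "\<And>\<phi> \<psi>. \<phi> \<in> M \<Longrightarrow> \<psi> \<in> M \<Longrightarrow> \<phi> \<noteq> \<psi> \<Longrightarrow> R \<phi> \<psi>"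
      "\<And>\<phi>. \<phi> \<in> dual_ball \<Longrightarrow> \<phi> \<in> M \<or> (\<exists>\<psi>\<in>M. \<not> R \<phi> \<psi>)"
      using maximal_separated[of R dual_ball, OF sym] by blast
    have "countable M"
    proof (rule asplund_separated_countable[OF assms M(1) that])
      show "\<exists>n. \<bar>\<phi> (c n) - \<psi> (c n)\<bar> > \<epsilon> * norm (c n)" if "\<phi> \<in> M" "\<psi> \<in> M" "\<phi> \<noteq> \<psi>" for \<phi> \<psi>
        using M(2)[OF that] by (simp add: R_def)
    qed
    moreover have "\<exists>\<psi>\<in>M. \<forall>n. \<bar>\<phi> (c n) - \<psi> (c n)\<bar> \<le> \<epsilon> * norm (c n)" if "\<phi> \<in> dual_ball" for \<phi>
    proof (cases "\<phi> \<in> M")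
      case True
      then show ?thesis using \<open>\<epsilon> > 0\<close> by (intro bexI[of _ \<phi>]) auto
    next
      case False
      then show ?thesis using M(3)[OF that] by (auto simp: R_def not_less)
    qed
    ultimately show ?thesis using M(1) by blast
  qed
  then have "\<forall>m::nat. \<exists>M. M \<subseteq> dual_ball \<and> countable M \<and>
      (\<forall>\<phi>\<in>dual_ball. \<exists>\<psi>\<in>M. \<forall>n. \<bar>\<phi> (c n) - \<psi> (c n)\<bar> \<le> inverse (Suc m) * norm (c n))" by simp
  then obtain M where M: "\<And>m::nat. M m \<subseteq> dual_ball" "\<And>m. countable (M m)"
    "\<And>m \<phi>. \<phi> \<in> dual_ball \<Longrightarrow> \<exists>\<psi>\<in>M m. \<forall>n. \<bar>\<phi> (c n) - \<psi> (c n)\<bar> \<le> inverse (Suc m) * norm (c n)"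
    by metis
  define Z where "Z = (\<Union>m. M m)"
  have Z: "countable Z" "Z \<subseteq> dual_ball" unfolding Z_def using M(1,2) by auto
  have "Z \<noteq> {}" using M(3)[OF zero_in_dual_ball, of 0] by (auto simp: Z_def)
  show ?thesis
  proof (rule that[of "from_nat_into Z"])
    show "range (from_nat_into Z) \<subseteq> dual_ball"
      using Z \<open>Z \<noteq> {}\<close> by (simp add: range_from_nat_into)
    fix \<phi> :: "'a \<Rightarrow> real" and \<epsilon> :: real assume \<phi>: "\<phi> \<in> dual_ball" and "\<epsilon> > 0"
    then obtain m where m: "inverse (Suc m) < \<epsilon>" using reals_Archimedean by blast
    obtain \<psi> where \<psi>: "\<psi> \<in> M m" "\<And>n. \<bar>\<phi> (c n) - \<psi> (c n)\<bar> \<le> inverse (Suc m) * norm (c n)"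
      using M(3)[OF \<phi>, of m] by blast
    then have "\<psi> \<in> Z" by (auto simp: Z_def)
    from from_nat_into_surj[OF Z(1) this] obtain j where j: "from_nat_into Z j = \<psi>" ..
    have "\<psi> \<in> dual_ball" using \<psi>(1) M(1) by blast
    then have "continuous_on UNIV (\<lambda>y. \<bar>\<phi> y - \<psi> y\<bar>)"
      by (intro continuous_intros linear_continuous_on dual_ball_bounded_linear \<phi>)
    moreover have "continuous_on UNIV (\<lambda>y::'a. inverse (Suc m) * norm y)"
      by (intro continuous_on_mult_left continuous_on_norm_id)
    ultimately have cont: "closed {y. \<bar>\<phi> y - \<psi> y\<bar> \<le> inverse (Suc m) * norm y}"
      by (rule closed_Collect_le)
    have sub: "closure (range c) \<subseteq> {y. \<bar>\<phi> y - \<psi> y\<bar> \<le> inverse (Suc m) * norm y}"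
      using \<psi>(2) by (intro closure_minimal cont) auto
    have "\<bar>\<phi> y - \<psi> y\<bar> \<le> \<epsilon> * norm y" if "y \<in> closure (range c)" for y
    proof -
      have "\<bar>\<phi> y - \<psi> y\<bar> \<le> inverse (Suc m) * norm y" using subsetD[OF sub that] by simp
      also have "\<dots> \<le> \<epsilon> * norm y" using m by (intro mult_right_mono) auto
      finally show ?thesis .
    qed
    then show "\<exists>j. \<forall>y\<in>closure (range c). \<bar>\<phi> y - from_nat_into Z j y\<bar> \<le> \<epsilon> * norm y"
      by (intro exI[of _ j]) (simp add: j)
  qed
qed

subsection \<open>Smooth gauges from rotund weights\<close>

text \<open>Upper semicontinuity is expressed by superlevel sets closed relative to
  \<open>K\<close>, since the function to be maximised is controlled only on
  \<open>dual_ball\<close>. The superlevel sets at the values of \<open>F\<close> have the finite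
  intersection property.\<close>

lemma compact_attains_sup_usc:
  fixes F :: "'a::topological_space \<Rightarrow> 'b::linorder"
  assumes "compact K" "K \<noteq> {}" and closed: "\<And>c. \<exists>L. closed L \<and> K \<inter> L = {x\<in>K. c \<le> F x}"
  obtains x where "x \<in> K" "\<And>y. y \<in> K \<Longrightarrow> F y \<le> F x"
proof -
  obtain L where L: "\<And>c. closed (L c)" "\<And>c. K \<inter> L c = {x\<in>K. c \<le> F x}" using closed by metis
  have "K \<inter> (\<Inter>y\<in>K. L (F y)) \<noteq> {}"
  proof (rule compact_imp_fip_image[OF assms(1)])
    show "closed (L (F y))" for y by (rule L)
    fix I' assume I: "finite I'" "I' \<subseteq> K"
    show "K \<inter> (\<Inter>y\<in>I'. L (F y)) \<noteq> {}"
    proof (cases "I' = {}")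
      case True
      then show ?thesis using assms(2) by simp
    next
      case False
      then have "Max (F ` I') \<in> F ` I'" using I(1) by simp
      then obtain x where x: "x \<in> I'" "F x = Max (F ` I')" by (metis imageE)
      then have "F y \<le> F x" if "y \<in> I'" for y using I(1) that by simp
      then have "x \<in> K \<inter> L (F y)" if "y \<in> I'" for y using L(2) x(1) I(2) that by auto
      then show ?thesis using x(1) by blast
    qed
  qed
  then obtain x where x: "x \<in> K" "\<And>y. y \<in> K \<Longrightarrow> x \<in> L (F y)" by blast
  then have "F y \<le> F x" if "y \<in> K" for y using L(2)[of "F y"] that by blast
  with x(1) show ?thesis by (rule that)
qed

text \<open>For a subspace \<open>Y\<close>, the distance of the restrictions in the norm of the
  dual of \<open>Y\<close>.\<close>

definition dual_dist :: "'a::real_normed_vector set \<Rightarrow> ('a \<Rightarrow> real) \<Rightarrow> ('a \<Rightarrow> real) \<Rightarrow> real" where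
  "dual_dist Y \<phi> \<psi> = (SUP y\<in>{y\<in>Y. norm y \<le> 1}. \<bar>\<phi> y - \<psi> y\<bar>)"

lemma dual_ball_diff_le: "\<phi> \<in> dual_ball \<Longrightarrow> \<psi> \<in> dual_ball \<Longrightarrow> \<bar>\<phi> y - \<psi> y\<bar> \<le> 2 * norm y"
  using dual_ballD(2)[of \<phi> y] dual_ballD(2)[of \<psi> y] by linarith

lemma dual_dist_bdd:
  assumes "\<phi> \<in> dual_ball" "\<psi> \<in> dual_ball"
  shows "bdd_above ((\<lambda>y. \<bar>\<phi> y - \<psi> y\<bar>) ` {y\<in>Y. norm y \<le> 1})"
proof (rule bdd_aboveI2)
  fix y assume "y \<in> {y \<in> Y. norm y \<le> 1}"
  then show "\<bar>\<phi> y - \<psi> y\<bar> \<le> 2" using dual_ball_diff_le[OF assms, of y] by simp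
qed

lemma dual_dist_upper:
  assumes "\<phi> \<in> dual_ball" "\<psi> \<in> dual_ball" "y \<in> Y" "norm y \<le> 1"
  shows "\<bar>\<phi> y - \<psi> y\<bar> \<le> dual_dist Y \<phi> \<psi>"
  unfolding dual_dist_def by (rule cSUP_upper[OF _ dual_dist_bdd]) (use assms in auto)

lemma dual_dist_least:
  assumes "0 \<in> Y" "\<And>y. y \<in> Y \<Longrightarrow> norm y \<le> 1 \<Longrightarrow> \<bar>\<phi> y - \<psi> y\<bar> \<le> c"
  shows "dual_dist Y \<phi> \<psi> \<le> c"
  unfolding dual_dist_def by (rule cSUP_least) (use assms in auto)

lemma dual_dist_bounds:
  assumes "\<phi> \<in> dual_ball" "\<psi> \<in> dual_ball" "0 \<in> Y"
  shows "0 \<le> dual_dist Y \<phi> \<psi>" "dual_dist Y \<phi> \<psi> \<le> 2"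
proof -
  show "0 \<le> dual_dist Y \<phi> \<psi>" using dual_dist_upper[OF assms(1,2,3)] by simp
  show "dual_dist Y \<phi> \<psi> \<le> 2"
  proof (rule dual_dist_least[OF assms(3)])
    fix y :: 'a assume "norm y \<le> 1"
    then show "\<bar>\<phi> y - \<psi> y\<bar> \<le> 2" using dual_ball_diff_le[OF assms(1,2), of y] by simp
  qed
qed

lemma dual_dist_apply:
  assumes "\<phi> \<in> dual_ball" "\<psi> \<in> dual_ball" "subspace Y" "y \<in> Y"
  shows "\<bar>\<phi> y - \<psi> y\<bar> \<le> dual_dist Y \<phi> \<psi> * norm y"
proof (cases "y = 0")
  case True
  then show ?thesis using assms(1,2) by (simp add: dual_ball_ops)
next
  case False
  let ?y = "(1 / norm y) *\<^sub>R y"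
  have "\<bar>\<phi> ?y - \<psi> ?y\<bar> \<le> dual_dist Y \<phi> \<psi>"
    using False assms by (intro dual_dist_upper subspace_scale) auto
  also have "\<phi> ?y - \<psi> ?y = (\<phi> y - \<psi> y) / norm y"
    using assms(1,2) by (simp add: dual_ball_ops diff_divide_distrib)
  finally show ?thesis using False by (simp add: field_simps)
qed

lemma dual_ball_midpoint:
  assumes "\<phi> \<in> dual_ball" "\<psi> \<in> dual_ball"
  shows "(\<lambda>x. (\<phi> x + \<psi> x) / 2) \<in> dual_ball"
proof -
  have "\<bar>(\<phi> x + \<psi> x) / 2\<bar> \<le> norm x" for x
    using dual_ballD(2)[OF assms(1), of x] dual_ballD(2)[OF assms(2), of x] by (simp add: abs_le_iff)
  moreover have "linear (\<lambda>x. (\<phi> x + \<psi> x) / 2)"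
    using assms by (intro linearI) (simp_all add: dual_ball_ops field_simps)
  ultimately show ?thesis by (simp add: dual_ball_def)
qed

lemma dual_dist_midpoint:
  assumes "\<phi> \<in> dual_ball" "\<psi> \<in> dual_ball" "\<zeta> \<in> dual_ball" "0 \<in> Y"
  shows "dual_dist Y (\<lambda>x. (\<phi> x + \<psi> x) / 2) \<zeta> \<le> (dual_dist Y \<phi> \<zeta> + dual_dist Y \<psi> \<zeta>) / 2"
proof (rule dual_dist_least[OF assms(4)])
  fix y assume "y \<in> Y" "norm y \<le> 1"
  then show "\<bar>(\<phi> y + \<psi> y) / 2 - \<zeta> y\<bar> \<le> (dual_dist Y \<phi> \<zeta> + dual_dist Y \<psi> \<zeta>) / 2"
    using dual_dist_upper[OF assms(1,3) \<open>y \<in> Y\<close> \<open>norm y \<le> 1\<close>]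
      dual_dist_upper[OF assms(2,3) \<open>y \<in> Y\<close> \<open>norm y \<le> 1\<close>] by (simp add: abs_le_iff field_simps)
qed

text \<open>A weak* lower semicontinuous convex function on the dual ball that is locally uniformly
  rotund for the norm of the dual of \<open>Y\<close> whenever the points \<open>z j\<close> are dense in that norm.\<close>

definition rotund_weight :: "'a::real_normed_vector set \<Rightarrow> (nat \<Rightarrow> 'a \<Rightarrow> real) \<Rightarrow> ('a \<Rightarrow> real) \<Rightarrow> real" where
  "rotund_weight Y z \<phi> = (\<Sum>j. (1/2) ^ j * (dual_dist Y \<phi> (z j))\<^sup>2)"

context
  fixes Y :: "'a::banach set" and z :: "nat \<Rightarrow> 'a \<Rightarrow> real"
  assumes Y: "subspace Y" and z: "range z \<subseteq> dual_ball"
begin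

lemma z_ball: "z j \<in> dual_ball" using z by blast

lemma zero_mem: "0 \<in> Y" using Y by (rule subspace_0)

lemma dual_dist_z_sq_le:
  assumes "\<phi> \<in> dual_ball" shows "(dual_dist Y \<phi> (z j))\<^sup>2 \<le> 4"
  using power_mono[OF dual_dist_bounds(2,1)[OF assms z_ball zero_mem], of j 2] by simp

lemma rotund_weight_summable:
  assumes "\<phi> \<in> dual_ball"
  shows "summable (\<lambda>j. (1/2) ^ j * (dual_dist Y \<phi> (z j))\<^sup>2)"
proof (rule summable_comparison_test')
  show "summable (\<lambda>j. (1/2::real) ^ j * 4)" by (intro summable_mult2 summable_geometric) simp
  show "norm ((1/2) ^ j * (dual_dist Y \<phi> (z j))\<^sup>2) \<le> (1/2) ^ j * 4" for j
    using dual_dist_z_sq_le[OF assms, of j] by (simp add: abs_mult)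
qed

lemma rotund_weight_bounds:
  assumes "\<phi> \<in> dual_ball"
  shows "0 \<le> rotund_weight Y z \<phi>" "rotund_weight Y z \<phi> \<le> 8"
proof -
  show "0 \<le> rotund_weight Y z \<phi>"
    unfolding rotund_weight_def using rotund_weight_summable[OF assms] by (intro suminf_nonneg) auto
  have "rotund_weight Y z \<phi> \<le> (\<Sum>j. (1/2::real) ^ j * 4)"
    unfolding rotund_weight_def using rotund_weight_summable[OF assms] dual_dist_z_sq_le[OF assms]
    by (intro suminf_le) (auto intro!: summable_mult2 summable_geometric mult_left_mono)
  also have "\<dots> = 8" by (subst suminf_mult2[symmetric]) (auto simp: suminf_geometric)
  finally show "rotund_weight Y z \<phi> \<le> 8" .
qed

text \<open>The weight is a supremum of continuous functions of \<phi>: finite partial sums in which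
  each distance is replaced by the value at a test vector \<open>y j\<close>. The closed set is
  taken relative to \<open>dual_ball\<close>, where the series converges.\<close>

lemma rotund_weight_superlevel_closed:
  "\<exists>L. closed L \<and> dual_ball \<inter> L = {\<phi>\<in>dual_ball. c \<le> \<phi> x - rotund_weight Y z \<phi>}"
proof -
  define L where "L = (\<Inter>J. \<Inter>y\<in>{y. \<forall>j. y j \<in> Y \<and> norm (y j) \<le> 1}.
    {\<phi>. (\<Sum>j<J. (1/2) ^ j * (\<phi> (y j) - z j (y j))\<^sup>2) \<le> \<phi> x - c})"
  have "closed L"
    unfolding L_def by (intro closed_INT ballI closed_Collect_le continuous_intros continuous_on_eval)
  moreover have "\<phi> \<in> L \<longleftrightarrow> c \<le> \<phi> x - rotund_weight Y z \<phi>" if \<phi>: "\<phi> \<in> dual_ball" for \<phi>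
  proof
    assume le: "c \<le> \<phi> x - rotund_weight Y z \<phi>"
    have "(\<Sum>j<J. (1/2) ^ j * (\<phi> (y j) - z j (y j))\<^sup>2) \<le> \<phi> x - c"
      if y: "\<forall>j. y j \<in> Y \<and> norm (y j) \<le> 1" for J y
    proof -
      have "(\<Sum>j<J. (1/2) ^ j * (\<phi> (y j) - z j (y j))\<^sup>2) \<le> (\<Sum>j<J. (1/2) ^ j * (dual_dist Y \<phi> (z j))\<^sup>2)"
        using dual_dist_upper[OF \<phi> z_ball] y
        by (intro sum_mono mult_left_mono abs_le_square_iff[THEN iffD1] order_trans[OF _ abs_ge_self]) auto
      also have "\<dots> \<le> rotund_weight Y z \<phi>"
        unfolding rotund_weight_def using rotund_weight_summable[OF \<phi>] by (intro sum_le_suminf) auto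
      finally show ?thesis using le by simp
    qed
    then show "\<phi> \<in> L" by (auto simp: L_def)
  next
    assume L: "\<phi> \<in> L"
    have "rotund_weight Y z \<phi> \<le> \<phi> x - c"
      unfolding rotund_weight_def
    proof (rule suminf_le_const[OF rotund_weight_summable[OF \<phi>]])
      fix J
      \<comment> \<open>The supremum in \<open>dual_dist\<close> need not be attained, so for each
        \<open>j\<close> a test vector with error \<open>1 / (n + 1)\<close> is chosen, and
        \<open>n\<close> tends to infinity with \<open>J\<close> fixed.\<close>
      have "\<exists>y\<in>{y\<in>Y. norm y \<le> 1}. dual_dist Y \<phi> (z j) - inverse (Suc n) < \<bar>\<phi> y - z j y\<bar>" for n j
        unfolding dual_dist_def
        using zero_mem
        by (intro less_cSUP_iff[OF _ dual_dist_bdd[OF \<phi> z_ball], THEN iffD1]) auto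
      then have "\<forall>n j. \<exists>y. y \<in> Y \<and> norm y \<le> 1 \<and> dual_dist Y \<phi> (z j) - inverse (Suc n) < \<bar>\<phi> y - z j y\<bar>"
        by blast
      then obtain y where y: "\<And>n j. y n j \<in> Y \<and> norm (y n j) \<le> 1"
        "\<And>n j. dual_dist Y \<phi> (z j) - inverse (Suc n) < \<bar>\<phi> (y n j) - z j (y n j)\<bar>"
        unfolding choice_iff by blast
      have lim: "(\<lambda>n. \<bar>\<phi> (y n j) - z j (y n j)\<bar>) \<longlonglongrightarrow> dual_dist Y \<phi> (z j)" for j
      proof (rule tendsto_sandwich)
        have "(\<lambda>n. dual_dist Y \<phi> (z j) - inverse (Suc n)) \<longlonglongrightarrow> dual_dist Y \<phi> (z j) - 0"
          by (intro tendsto_intros LIMSEQ_inverse_real_of_nat)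
        then show "(\<lambda>n. dual_dist Y \<phi> (z j) - inverse (Suc n)) \<longlonglongrightarrow> dual_dist Y \<phi> (z j)" by simp
        show "\<forall>\<^sub>F n in sequentially. dual_dist Y \<phi> (z j) - inverse (Suc n) \<le> \<bar>\<phi> (y n j) - z j (y n j)\<bar>"
          using y(2) by (intro always_eventually allI less_imp_le)
        show "\<forall>\<^sub>F n in sequentially. \<bar>\<phi> (y n j) - z j (y n j)\<bar> \<le> dual_dist Y \<phi> (z j)"
          using y(1) dual_dist_upper[OF \<phi> z_ball] by (intro always_eventually allI) blast
      qed simp
      have "(\<lambda>n. \<Sum>j<J. (1/2) ^ j * \<bar>\<phi> (y n j) - z j (y n j)\<bar>\<^sup>2)
          \<longlonglongrightarrow> (\<Sum>j<J. (1/2) ^ j * (dual_dist Y \<phi> (z j))\<^sup>2)"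
        by (intro tendsto_intros lim)
      moreover have "(\<Sum>j<J. (1/2) ^ j * \<bar>\<phi> (y n j) - z j (y n j)\<bar>\<^sup>2) \<le> \<phi> x - c" for n
        using L y(1) unfolding L_def by simp
      ultimately show "(\<Sum>j<J. (1/2) ^ j * (dual_dist Y \<phi> (z j))\<^sup>2) \<le> \<phi> x - c"
        by (intro LIMSEQ_le_const2) auto
    qed
    then show "c \<le> \<phi> x - rotund_weight Y z \<phi>" by simp
  qed
  ultimately show ?thesis by (intro exI[of _ L]) auto
qed

text \<open>Termwise, \<open>a\<^sup>2 / 2 + b\<^sup>2 / 2 - ((a + b) / 2)\<^sup>2 = (a - b)\<^sup>2
  / 4\<close>, and the distance from the midpoint is at most \<open>(a + b) / 2\<close>. All terms
  of the convexity gap are nonnegative, so the gap dominates each of them.\<close>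

lemma rotund_weight_midpoint:
  assumes "\<phi> \<in> dual_ball" "\<psi> \<in> dual_ball"
  shows "(1/2) ^ j * (dual_dist Y \<phi> (z j) - dual_dist Y \<psi> (z j))\<^sup>2 / 4
    \<le> rotund_weight Y z \<phi> / 2 + rotund_weight Y z \<psi> / 2 - rotund_weight Y z (\<lambda>x. (\<phi> x + \<psi> x) / 2)"
proof -
  let ?m = "\<lambda>x. (\<phi> x + \<psi> x) / 2"
  define a where "a = (\<lambda>j. dual_dist Y \<phi> (z j))"
  define b where "b = (\<lambda>j. dual_dist Y \<psi> (z j))"
  define m where "m = (\<lambda>j. dual_dist Y ?m (z j))"
  define t where "t = (\<lambda>j. ((1/2) ^ j * (a j)\<^sup>2) / 2 + ((1/2) ^ j * (b j)\<^sup>2) / 2 - (1/2) ^ j * (m j)\<^sup>2)"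
  have m: "?m \<in> dual_ball" using assms by (rule dual_ball_midpoint)
  have sums: "(\<lambda>j. (1/2) ^ j * (a j)\<^sup>2) sums rotund_weight Y z \<phi>" "(\<lambda>j. (1/2) ^ j * (b j)\<^sup>2) sums rotund_weight Y z \<psi>"
    "(\<lambda>j. (1/2) ^ j * (m j)\<^sup>2) sums rotund_weight Y z ?m"
    unfolding rotund_weight_def a_def b_def m_def
    using rotund_weight_summable assms m by (auto intro: summable_sums)
  have t: "t sums (rotund_weight Y z \<phi> / 2 + rotund_weight Y z \<psi> / 2 - rotund_weight Y z ?m)"
    unfolding t_def by (intro sums_add sums_diff sums_divide sums)
  have bound: "(1/2) ^ j * (a j - b j)\<^sup>2 / 4 \<le> t j" for j
  proof -
    have "0 \<le> m j" "m j \<le> (a j + b j) / 2"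
      unfolding a_def b_def m_def using dual_dist_midpoint[OF assms z_ball zero_mem]
        dual_dist_bounds(1)[OF m z_ball zero_mem] by auto
    then have "(m j)\<^sup>2 \<le> ((a j + b j) / 2)\<^sup>2" by (intro power_mono)
    then have "(a j - b j)\<^sup>2 / 4 \<le> (a j)\<^sup>2 / 2 + (b j)\<^sup>2 / 2 - (m j)\<^sup>2"
      by (simp add: power2_eq_square field_simps)
    then have "(1/2) ^ j * ((a j - b j)\<^sup>2 / 4) \<le> (1/2) ^ j * ((a j)\<^sup>2 / 2 + (b j)\<^sup>2 / 2 - (m j)\<^sup>2)"
      by (intro mult_left_mono) auto
    then show ?thesis by (simp add: t_def algebra_simps)
  qed
  have "0 \<le> t j" for j using bound[of j] by (rule order_trans[rotated]) simp
  then have "sum t {j} \<le> suminf t" using t by (intro sum_le_suminf) (auto simp: sums_iff)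
  with bound[of j] t show ?thesis by (simp add: sums_iff a_def b_def)
qed

end

text \<open>The gauge symmetrises the conjugate of \<open>rotund_weight\<close>: rotundity of the weight makes
  near-maximisers converge in norm, and this is Frechet smoothness of the conjugate.\<close>

lemma asplund_smooth_gauge:
  fixes c :: "nat \<Rightarrow> 'a::banach"
  assumes asp: "asplund_space TYPE('a)" and Y: "subspace Y" "Y = closure (range c)"
  obtains \<kappa> R where "R > 0" "\<kappa> 0 = (0::real)" "\<And>u. 0 \<le> \<kappa> u" "\<And>u v. \<bar>\<kappa> u - \<kappa> v\<bar> \<le> 2 * norm (u - v)"
    "\<And>u. norm u \<ge> R \<Longrightarrow> norm u \<le> \<kappa> u"
    "\<And>u. u \<in> Y \<Longrightarrow> \<exists>D. (\<forall>h. \<bar>D h\<bar> \<le> 2 * norm h) \<and> (\<kappa> has_derivative D) (at u within Y)"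
proof -
  obtain z :: "nat \<Rightarrow> 'a \<Rightarrow> real" where z: "range z \<subseteq> dual_ball"
    and dense: "\<And>\<phi> \<epsilon>. \<phi> \<in> dual_ball \<Longrightarrow> \<epsilon> > 0 \<Longrightarrow> \<exists>j. \<forall>y\<in>Y. \<bar>\<phi> y - z j y\<bar> \<le> \<epsilon> * norm y"
    using asplund_dual_ball_separable[OF asp, of c] unfolding Y(2) by blast
  note zb = z_ball[OF Y(1) z] and N_nonneg = rotund_weight_bounds(1)[OF Y(1) z]
    and N_le = rotund_weight_bounds(2)[OF Y(1) z] and mid = rotund_weight_midpoint[OF Y(1) z]
  define N where "N = rotund_weight Y z"
  have "\<exists>\<phi>. \<phi> \<in> dual_ball \<and> (\<forall>\<psi>\<in>dual_ball. \<psi> x - N \<psi> \<le> \<phi> x - N \<phi>)" for x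
    by (rule compact_attains_sup_usc[OF compact_dual_ball _
          rotund_weight_superlevel_closed[OF Y(1) z, of _ x], folded N_def])
      (use zero_in_dual_ball in auto)
  then obtain m where m: "\<And>x. m x \<in> dual_ball" "\<And>x \<psi>. \<psi> \<in> dual_ball \<Longrightarrow> \<psi> x - N \<psi> \<le> m x x - N (m x)"
    by metis
  \<comment> \<open>This is the convex conjugate of \<open>N\<close> on the dual ball; the maximiser
    \<open>m x\<close> will be its derivative at \<open>x\<close> along \<open>Y\<close>.\<close>
  define k where "k = (\<lambda>x. m x x - N (m x))"
  have k_ge: "\<psi> x - N \<psi> \<le> k x" if "\<psi> \<in> dual_ball" for \<psi> x unfolding k_def using that by (rule m)
  have k_lip: "k x - k y \<le> norm (x - y)" for x y
    using k_ge[OF m(1), of x y] dual_ballD(2)[OF m(1), of x "x - y"]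
    by (simp add: k_def dual_ball_ops[OF m(1)])
  \<comment> \<open>The 9 is the bound 8 on the weight plus a loss of 1 from almost norming
    \<open>x\<close>.\<close>
  have k_coercive: "norm x - 9 \<le> k x" for x
  proof -
    obtain \<phi> where "\<phi> \<in> dual_ball" "\<phi> x \<ge> norm x - 1" using asplund_norming[OF asp, of 1 x] by auto
    then show ?thesis using k_ge[of \<phi> x] N_le[of \<phi>] by (simp add: N_def)
  qed
  have k0: "k 0 \<le> 0" using N_nonneg[OF m(1), of 0] by (simp add: k_def N_def dual_ball_ops[OF m(1)])
  \<comment> \<open>Testing maximality at the midpoint of \<open>m x\<close> and \<psi> bounds the
    convexity gap by \<open>\<eta> / 2\<close>, so both are almost equally far from
    \<open>z j\<close>. With \<open>z j\<close> within \<open>e / 3\<close> of \<open>m x\<close>,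
    the triangle inequality gives closeness \<open>e\<close>.\<close>
  have near: "\<exists>\<eta>>0. \<forall>\<psi>\<in>dual_ball. \<psi> x - N \<psi> \<ge> k x - \<eta> \<longrightarrow> (\<forall>y\<in>Y. \<bar>\<psi> y - m x y\<bar> \<le> e * norm y)"
    if "e > 0" for e x
  proof -
    obtain j where j: "\<forall>y\<in>Y. \<bar>m x y - z j y\<bar> \<le> e / 3 * norm y" using dense[OF m(1), of "e / 3" x] \<open>e > 0\<close> by auto
    have mj: "dual_dist Y (m x) (z j) \<le> e / 3"
    proof (rule dual_dist_least[OF subspace_0[OF Y(1)]])
      fix y assume y: "y \<in> Y" "norm y \<le> 1"
      have "e / 3 * norm y \<le> e / 3 * 1" using y that by (intro mult_left_mono) auto
      then show "\<bar>m x y - z j y\<bar> \<le> e / 3" using j y(1) by fastforce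
    qed
    define \<eta> where "\<eta> = (1/2) ^ j * (e / 3)\<^sup>2 / 4"
    have "\<bar>\<psi> y - m x y\<bar> \<le> e * norm y"
      if \<psi>: "\<psi> \<in> dual_ball" "\<psi> x - N \<psi> \<ge> k x - \<eta>" and y: "y \<in> Y" for \<psi> y
    proof -
      have "(\<lambda>x'. (m x x' + \<psi> x') / 2) \<in> dual_ball" using m(1) \<psi>(1) by (rule dual_ball_midpoint)
      from k_ge[OF this, of x] have "N (m x) / 2 + N \<psi> / 2 - N (\<lambda>x'. (m x x' + \<psi> x') / 2) \<le> \<eta> / 2"
        using \<psi>(2) by (simp add: k_def field_simps)
      then have "(1/2) ^ j * (dual_dist Y (m x) (z j) - dual_dist Y \<psi> (z j))\<^sup>2 / 4 \<le> \<eta> / 2"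
        using mid[OF m(1) \<psi>(1), of j x] unfolding N_def by linarith
      also have "\<dots> \<le> (1/2) ^ j * (e / 3)\<^sup>2 / 4" by (simp add: \<eta>_def)
      finally have "(dual_dist Y (m x) (z j) - dual_dist Y \<psi> (z j))\<^sup>2 \<le> (e / 3)\<^sup>2"
        by (simp add: divide_right_mono)
      then have "\<bar>dual_dist Y (m x) (z j) - dual_dist Y \<psi> (z j)\<bar> \<le> e / 3"
        using \<open>e > 0\<close> by (simp add: abs_le_square_iff[symmetric])
      then have "dual_dist Y \<psi> (z j) \<le> 2 * e / 3" using mj by linarith
      then have "dual_dist Y \<psi> (z j) * norm y \<le> 2 * e / 3 * norm y" by (intro mult_right_mono) auto
      then have "\<bar>\<psi> y - z j y\<bar> \<le> 2 * e / 3 * norm y" using dual_dist_apply[OF \<psi>(1) zb Y(1) y, of j] by linarith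
      moreover have "\<bar>m x y - z j y\<bar> \<le> e / 3 * norm y" using j y by blast
      ultimately show ?thesis by linarith
    qed
    moreover have "\<eta> > 0" using \<open>e > 0\<close> by (simp add: \<eta>_def)
    ultimately show ?thesis by blast
  qed
  \<comment> \<open>Maximality gives \<open>m x (y - x) \<le> k y - k x \<le> m y (y - x)\<close>.
    For \<open>y\<close> near \<open>x\<close>, \<open>m y\<close> almost maximises at
    \<open>x\<close> too, so by \<open>near\<close> the two bounds differ by at most
    \<open>e * norm (y - x)\<close>.\<close>
  have k_deriv: "(k has_derivative m x) (at x within Y)" if x: "x \<in> Y" for x
    unfolding has_derivative_within_alt
  proof (intro conjI allI impI)
    show "bounded_linear (m x)" using m(1) by (rule dual_ball_bounded_linear)
    fix e :: real assume "e > 0"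
    then obtain \<eta> where \<eta>: "\<eta> > 0"
      "\<And>\<psi> y. \<psi> \<in> dual_ball \<Longrightarrow> \<psi> x - N \<psi> \<ge> k x - \<eta> \<Longrightarrow> y \<in> Y \<Longrightarrow> \<bar>\<psi> y - m x y\<bar> \<le> e * norm y"
      using near[of e x] by blast
    have "norm (k y - k x - m x (y - x)) \<le> e * norm (y - x)" if y: "y \<in> Y" "norm (y - x) < \<eta> / 2" for y
    proof -
      have "m y x - N (m y) = k y - m y (y - x)" by (simp add: k_def dual_ball_ops[OF m(1)])
      moreover have "k y \<ge> k x - norm (y - x)" using k_lip[of x y] by (simp add: norm_minus_commute)
      moreover have "m y (y - x) \<le> norm (y - x)" using dual_ballD(2)[OF m(1), of y "y - x"] by simp
      ultimately have "m y x - N (m y) \<ge> k x - \<eta>" using y(2) by linarith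
      then have "\<bar>m y (y - x) - m x (y - x)\<bar> \<le> e * norm (y - x)"
        using y(1) x Y(1) by (intro \<eta>(2) m(1) subspace_diff)
      moreover have "k y - k x \<le> m y (y - x)"
        using k_ge[OF m(1), of y x] by (simp add: k_def dual_ball_ops[OF m(1)])
      moreover have "k y - k x \<ge> m x (y - x)"
        using k_ge[OF m(1), of x y] by (simp add: k_def dual_ball_ops[OF m(1)])
      ultimately show ?thesis by (simp add: abs_le_iff)
    qed
    then show "\<exists>d>0. \<forall>y\<in>Y. norm (y - x) < d \<longrightarrow> norm (k y - k x - m x (y - x)) \<le> e * norm (y - x)"
      using \<eta>(1) by (intro exI[of _ "\<eta> / 2"]) auto
  qed
  \<comment> \<open>\<open>k\<close> itself need not be minimal at 0; its symmetric second
    difference is, by convexity.\<close>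
  define \<kappa> where "\<kappa> = (\<lambda>u. k u + k (- u) - 2 * k 0)"
  show ?thesis
  \<comment> \<open>Coercivity used twice and \<open>k 0 \<le> 0\<close> give
    \<open>2 * norm u - 18 \<le> \<kappa> u\<close>, which is at least \<open>norm u\<close> from
    radius 18 on.\<close>
  proof (rule that[of 18 \<kappa>])
    show "\<kappa> 0 = 0" by (simp add: \<kappa>_def)
    show "0 \<le> \<kappa> u" for u
      using k_ge[OF m(1), of 0 u] k_ge[OF m(1), of 0 "- u"] by (simp add: \<kappa>_def k_def dual_ball_ops[OF m(1)])
    show "\<bar>\<kappa> u - \<kappa> v\<bar> \<le> 2 * norm (u - v)" for u v
      using k_lip[of u v] k_lip[of v u] k_lip[of "- u" "- v"] k_lip[of "- v" "- u"]
      by (simp add: \<kappa>_def norm_minus_commute abs_le_iff)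
    show "norm u \<le> \<kappa> u" if "norm u \<ge> 18" for u
      using that k_coercive[of u] k_coercive[of "- u"] k0 by (simp add: \<kappa>_def)
    fix u assume u: "u \<in> Y"
    have neg: "uminus ` Y = Y"
      using subspace_neg[OF Y(1)] by (auto intro!: image_eqI[where x = "- _"])
    have "((\<lambda>u. k (- u)) has_derivative (\<lambda>h. m (- u) (- h))) (at u within Y)"
      using has_derivative_in_compose[OF has_derivative_minus[OF has_derivative_ident], of k "m (- u)" u Y]
        k_deriv[OF subspace_neg[OF Y(1) u]] by (simp add: neg)
    then have "(\<kappa> has_derivative (\<lambda>h. m u h + m (- u) (- h) - 0)) (at u within Y)"
      unfolding \<kappa>_def by (intro has_derivative_diff has_derivative_add k_deriv u) auto
    moreover have "\<bar>m u h + m (- u) (- h) - 0\<bar> \<le> 2 * norm h" for h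
      using dual_ballD(2)[OF m(1), of u h] dual_ballD(2)[OF m(1), of "- u" "- h"] by (simp add: abs_le_iff)
    ultimately show "\<exists>D. (\<forall>h. \<bar>D h\<bar> \<le> 2 * norm h) \<and> (\<kappa> has_derivative D) (at u within Y)"
      by (intro exI[of _ "\<lambda>h. m u h + m (- u) (- h) - 0"] conjI allI)
  qed simp
qed

subsection \<open>Smooth variational principle\<close>

text \<open>The remainder is at most \<open>(s - t)\<^sup>2\<close> on whichever side of the kink 1
  the two points lie, so \<open>d = e\<close> works in the definition of the derivative.\<close>

lemma has_derivative_truncated_square:
  fixes t :: real
  shows "((\<lambda>s. (max 0 (1 - s))\<^sup>2) has_derivative (\<lambda>h. - 2 * max 0 (1 - t) * h)) (at t)"
  unfolding has_derivative_at_alt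
proof (intro conjI allI impI)
  show "bounded_linear (\<lambda>h. - 2 * max 0 (1 - t) * h)" by (rule bounded_linear_mult_right)
  have quadratic: "\<bar>(max 0 (1 - s))\<^sup>2 - (max 0 (1 - t))\<^sup>2 - (- 2 * max 0 (1 - t) * (s - t))\<bar> \<le> (s - t)\<^sup>2" for s
  proof (cases "s \<le> 1"; cases "t \<le> 1")
    assume "s \<le> 1" "t \<le> 1"
    then have max: "max 0 (1 - s) = 1 - s" "max 0 (1 - t) = 1 - t" by auto
    have "(1 - s)\<^sup>2 - (1 - t)\<^sup>2 - (- 2 * (1 - t) * (s - t)) = (s - t)\<^sup>2"
      by (simp add: power2_eq_square algebra_simps)
    then show ?thesis unfolding max by simp
  next
    assume st: "s \<le> 1" "\<not> t \<le> 1"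
    then have "(1 - s)\<^sup>2 \<le> (t - s)\<^sup>2" by (intro power_mono) auto
    then show ?thesis using st by (simp add: max_def power2_commute)
  next
    assume st: "\<not> s \<le> 1" "t \<le> 1"
    then have max: "max 0 (1 - s) = 0" "max 0 (1 - t) = 1 - t" by auto
    have "(1 - t) * (1 - t) \<le> (1 - t) * (s - t)" "0 \<le> (1 - t) * (s - t)"
      using st by (auto intro!: mult_left_mono mult_nonneg_nonneg)
    then have "0 \<le> 2 * (1 - t) * (s - t) - (1 - t)\<^sup>2"
      unfolding power2_eq_square mult.assoc by linarith
    moreover have "2 * (1 - t) * (s - t) - (1 - t)\<^sup>2 = (s - t)\<^sup>2 - (s - 1)\<^sup>2"
      by (simp add: power2_eq_square algebra_simps)
    moreover have "0\<^sup>2 - (1 - t)\<^sup>2 - (- 2 * (1 - t) * (s - t)) = 2 * (1 - t) * (s - t) - (1 - t)\<^sup>2"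
      by (simp add: algebra_simps)
    ultimately show ?thesis unfolding max using zero_le_power2[of "s - 1"] by linarith
  qed (simp add: max_def)
  fix e :: real assume "e > 0"
  have "norm ((max 0 (1 - s))\<^sup>2 - (max 0 (1 - t))\<^sup>2 - (- 2 * max 0 (1 - t) * (s - t))) \<le> e * norm (s - t)"
    if "norm (s - t) < e" for s
  proof -
    have "(s - t)\<^sup>2 = \<bar>s - t\<bar> * \<bar>s - t\<bar>" by (simp add: power2_eq_square)
    also have "\<dots> \<le> e * \<bar>s - t\<bar>" using that by (intro mult_right_mono) auto
    finally show ?thesis using quadratic[of s] by simp
  qed
  then show "\<exists>d>0. \<forall>s. norm (s - t) < d \<longrightarrow>
      norm ((max 0 (1 - s))\<^sup>2 - (max 0 (1 - t))\<^sup>2 - (- 2 * max 0 (1 - t) * (s - t))) \<le> e * norm (s - t)"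
    using \<open>e > 0\<close> by blast
qed

text \<open>The bump is \<open>(max 0 (1 - \<kappa> u))\<^sup>2\<close>. The truncated square has
  slope at most 2 on nonnegative arguments and \<kappa> is 2-Lipschitz, whence the 4. From radius
  \<open>max R 1\<close> on, \<open>\<kappa> u \<ge> norm u \<ge> 1\<close>.\<close>

lemma smooth_bump:
  fixes \<kappa> :: "'a::real_normed_vector \<Rightarrow> real"
  assumes "\<kappa> 0 = 0" "\<And>u. 0 \<le> \<kappa> u" and lip: "\<And>u v. \<bar>\<kappa> u - \<kappa> v\<bar> \<le> 2 * norm (u - v)"
    and "\<And>u. norm u \<ge> R \<Longrightarrow> norm u \<le> \<kappa> u"
    and deriv: "\<And>u. u \<in> Y \<Longrightarrow> \<exists>D. (\<forall>h. \<bar>D h\<bar> \<le> 2 * norm h) \<and> (\<kappa> has_derivative D) (at u within Y)"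
  obtains b where "b 0 = (1::real)" "\<And>u. 0 \<le> b u" "\<And>u. b u \<le> 1" "\<And>u v. \<bar>b u - b v\<bar> \<le> 4 * norm (u - v)"
    "\<And>u. norm u \<ge> max R 1 \<Longrightarrow> b u = 0"
    "\<And>u. u \<in> Y \<Longrightarrow> \<exists>D. (\<forall>h. \<bar>D h\<bar> \<le> 4 * norm h) \<and> (b has_derivative D) (at u within Y)"
proof
  define b where "b = (\<lambda>u. (max 0 (1 - \<kappa> u))\<^sup>2)"
  have range: "0 \<le> max 0 (1 - \<kappa> u)" "max 0 (1 - \<kappa> u) \<le> 1" for u using assms(2)[of u] by auto
  show "b 0 = 1" using assms(1) by (simp add: b_def)
  show "0 \<le> b u" for u by (simp add: b_def)
  show "b u \<le> 1" for u unfolding b_def using range by (rule power_le_one)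
  show "\<bar>b u - b v\<bar> \<le> 4 * norm (u - v)" for u v
  proof -
    let ?p = "max 0 (1 - \<kappa> u)" and ?q = "max 0 (1 - \<kappa> v)"
    have "\<bar>b u - b v\<bar> = \<bar>?p + ?q\<bar> * \<bar>?p - ?q\<bar>"
      unfolding b_def abs_mult[symmetric] by (simp add: power2_eq_square algebra_simps)
    also have "\<dots> \<le> 2 * (2 * norm (u - v))"
    proof (rule mult_mono)
      show "\<bar>?p + ?q\<bar> \<le> 2" using range[of u] range[of v] by linarith
      have "\<bar>?p - ?q\<bar> \<le> \<bar>\<kappa> u - \<kappa> v\<bar>" by linarith
      then show "\<bar>?p - ?q\<bar> \<le> 2 * norm (u - v)" using lip[of u v] by linarith
    qed auto
    finally show ?thesis by simp
  qed
  show "b u = 0" if "norm u \<ge> max R 1" for u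
    using assms(4)[of u] that by (simp add: b_def)
  fix u assume "u \<in> Y"
  then obtain D where D: "\<And>h. \<bar>D h\<bar> \<le> 2 * norm h" "(\<kappa> has_derivative D) (at u within Y)"
    using deriv by blast
  have "(b has_derivative (\<lambda>h. - 2 * max 0 (1 - \<kappa> u) * D h)) (at u within Y)"
    unfolding b_def using has_derivative_compose[OF D(2) has_derivative_truncated_square] .
  moreover have "\<bar>- 2 * max 0 (1 - \<kappa> u) * D h\<bar> \<le> 4 * norm h" for h
  proof -
    have "\<bar>- 2 * max 0 (1 - \<kappa> u) * D h\<bar> = 2 * max 0 (1 - \<kappa> u) * \<bar>D h\<bar>" using range[of u] by (simp add: abs_mult)
    also have "\<dots> \<le> 2 * 1 * (2 * norm h)" using range[of u] D(1)[of h] by (intro mult_mono) auto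
    finally show ?thesis by simp
  qed
  ultimately show "\<exists>D. (\<forall>h. \<bar>D h\<bar> \<le> 4 * norm h) \<and> (b has_derivative D) (at u within Y)"
    by (intro exI[of _ "\<lambda>h. - 2 * max 0 (1 - \<kappa> u) * D h"] conjI allI)
qed

lemma near_minimizer:
  fixes g :: "'a \<Rightarrow> real"
  assumes "Y \<noteq> {}" "\<And>u. u \<in> Y \<Longrightarrow> m \<le> g u" "\<eta> > 0"
  obtains x where "x \<in> Y" "\<And>u. u \<in> Y \<Longrightarrow> g x \<le> g u + \<eta>"
proof -
  have bdd: "bdd_below (g ` Y)" using assms(2) by (rule bdd_belowI2)
  have "(INF u\<in>Y. g u) < (INF u\<in>Y. g u) + \<eta>" using assms(3) by simp
  then obtain x where x: "x \<in> Y" "g x < (INF u\<in>Y. g u) + \<eta>"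
    using cINF_less_iff[OF assms(1) bdd] by blast
  moreover have "g x \<le> g u + \<eta>" if "u \<in> Y" for u
    using cINF_lower[OF bdd that] x(2) by linarith
  ultimately show ?thesis using that by blast
qed

text \<open>Bumps of geometrically decreasing height and radius are placed at successive near-minimisers;
  each bump confines all later near-minimisers to its support.\<close>

lemma smooth_variational_principle:
  fixes \<phi> b :: "'a::banach \<Rightarrow> real"
  assumes Y: "subspace Y" "closed Y"
    and b: "b 0 = 1" "\<And>u. 0 \<le> b u" "\<And>u. b u \<le> 1" "\<And>u v. \<bar>b u - b v\<bar> \<le> L * norm (u - v)"
      "\<And>u. norm u \<ge> R \<Longrightarrow> b u = 0"
    and b_deriv: "\<And>u. u \<in> Y \<Longrightarrow> \<exists>D. (\<forall>h. \<bar>D h\<bar> \<le> L * norm h) \<and> (b has_derivative D) (at u within Y)"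
    and "R > 0" "L \<ge> 0" "\<epsilon> > 0"
    and \<phi>: "continuous_on Y \<phi>" "\<And>u. u \<in> Y \<Longrightarrow> m \<le> \<phi> u"
  obtains x \<beta> D where "x \<in> Y" "\<And>u. 0 \<le> \<beta> u" "\<And>u. \<beta> u \<le> \<epsilon>" "(\<beta> has_derivative D) (at x within Y)"
    "\<And>h. \<bar>D h\<bar> \<le> \<epsilon> * norm h" "\<And>u. u \<in> Y \<Longrightarrow> \<phi> x - \<beta> x \<le> \<phi> u - \<beta> u"
proof -
  \<comment> \<open>\<open>K\<close> makes both the height \<open>a n\<close> of bump
    \<open>n\<close> and its Lipschitz constant \<open>a n * (L * s n)\<close> at most
    \<open>w n\<close>, and the \<open>w n\<close> sum to \<epsilon>. Heights fall by 4 but radii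
    only by 2, so that these Lipschitz constants still halve at each step.\<close>
  define K where "K = 2 + 2 * L * R"
  define a where "a = (\<lambda>n::nat. \<epsilon> / (K * 4 ^ n))"
  define s where "s = (\<lambda>n::nat. R * 2 ^ n)"
  define w where "w = (\<lambda>n::nat. \<epsilon> * (1/2) ^ Suc n)"
  have K: "K \<ge> 2" "K \<ge> 2 * L * R" using \<open>R > 0\<close> \<open>L \<ge> 0\<close> by (auto simp: K_def)
  have a_pos: "a n > 0" for n using K \<open>\<epsilon> > 0\<close> by (simp add: a_def)
  have a_Suc: "a (Suc n) = a n / 4" for n by (simp add: a_def)
  have s_pos: "s n > 0" for n using \<open>R > 0\<close> by (simp add: s_def)
  have pow4: "(4::real) ^ n = 2 ^ n * 2 ^ n" for n by (simp flip: power_mult_distrib)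
  have a_le: "a n \<le> w n" for n
  proof -
    have "(2::real) * 2 ^ n * 1 \<le> K * 2 ^ n * 2 ^ n" using K by (intro mult_mono) auto
    then have "\<epsilon> / (K * 4 ^ n) \<le> \<epsilon> / (2 * 2 ^ n)"
      using \<open>\<epsilon> > 0\<close> K by (intro divide_left_mono) (auto simp: pow4 mult_ac)
    then show ?thesis by (simp add: a_def w_def power_divide)
  qed
  have a_L: "a n * (L * s n) \<le> w n" for n
  proof -
    have "a n * (L * s n) = \<epsilon> * (L * R) / (K * 2 ^ n)" by (simp add: a_def s_def pow4)
    also have "\<dots> \<le> \<epsilon> * (K / 2) / (K * 2 ^ n)"
      using K \<open>\<epsilon> > 0\<close> by (intro divide_right_mono mult_left_mono) auto
    also have "\<dots> = w n" using K by (simp add: w_def power_divide)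
    finally show ?thesis .
  qed
  have w_sums: "w sums \<epsilon>"
    unfolding w_def using sums_mult[OF power_half_series, of \<epsilon>] by simp
  have w_pos: "w n \<ge> 0" for n using \<open>\<epsilon> > 0\<close> by (simp add: w_def)
  define \<gamma> where "\<gamma> = (\<lambda>n c u. a n * b (s n *\<^sub>R (u - c)))"
  \<comment> \<open>A state is the perturbation \<open>B\<close> so far with a centre
    \<open>c\<close> for the next bump. The upper bound on \<open>B\<close> keeps
    \<open>\<phi> - B\<close> bounded below, as the next near-minimiser requires. The tolerance is
    half the height of the bump to be placed at \<open>c\<close>.\<close>
  define P where "P = (\<lambda>n (B, c). c \<in> Y \<and> (n = 0 \<longrightarrow> B = (\<lambda>u. 0)) \<and> (\<exists>M. \<forall>u. B u \<le> M) \<and>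
     (\<forall>u\<in>Y. \<phi> c - B c \<le> \<phi> u - B u + a n / 2))"
  have "Y \<noteq> {}" using subspace_0[OF Y(1)] by blast
  have step: "\<exists>c. P n (B, c)" if B: "\<And>u. B u \<le> M" "n = 0 \<longrightarrow> B = (\<lambda>u. 0)" for n B and M :: real
  proof -
    have "m - M \<le> \<phi> u - B u" if "u \<in> Y" for u using \<phi>(2)[OF that] B(1)[of u] by linarith
    then obtain c where "c \<in> Y" "\<And>u. u \<in> Y \<Longrightarrow> \<phi> c - B c \<le> \<phi> u - B u + a n / 2"
      using near_minimizer[OF \<open>Y \<noteq> {}\<close>, of "m - M" "\<lambda>u. \<phi> u - B u" "a n / 2"] a_pos[of n] by auto
    then show ?thesis using B by (auto simp: P_def)
  qed
  have "\<exists>f. \<forall>n. P n (f n) \<and> fst (f (Suc n)) = (\<lambda>u. fst (f n) u + \<gamma> n (snd (f n)) u)"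
  proof (rule dependent_nat_choice)
    obtain c where "P 0 (\<lambda>u. 0, c)" using step[of "\<lambda>u. 0" 0 0] by auto
    then show "\<exists>x. P 0 x" by blast
    fix Bc n assume "P n Bc"
    moreover obtain B c where Bc: "Bc = (B, c)" by (cases Bc)
    ultimately obtain M where M: "\<And>u. B u \<le> M" by (auto simp: P_def)
    have "B u + \<gamma> n c u \<le> M + a n" for u
    proof -
      have "\<gamma> n c u \<le> a n * 1" unfolding \<gamma>_def using a_pos[of n] b(3) by (intro mult_left_mono) auto
      with M[of u] show ?thesis by linarith
    qed
    then obtain c' where "P (Suc n) (\<lambda>u. B u + \<gamma> n c u, c')" using step[of "\<lambda>u. B u + \<gamma> n c u"] by blast
    then show "\<exists>y. P (Suc n) y \<and> fst y = (\<lambda>u. fst Bc u + \<gamma> n (snd Bc) u)"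
      using Bc by (intro exI[of _ "(\<lambda>u. B u + \<gamma> n c u, c')"]) simp
  qed
  then obtain f where f: "\<And>n. P n (f n)" "\<And>n. fst (f (Suc n)) = (\<lambda>u. fst (f n) u + \<gamma> n (snd (f n)) u)"
    by blast
  define x where "x = (\<lambda>n. snd (f n))"
  define g where "g = (\<lambda>n. \<gamma> n (x n))"
  have f_eq: "f n = (fst (f n), x n)" for n by (simp add: x_def)
  have B: "fst (f n) u = (\<Sum>i<n. g i u)" for n u
  proof (induction n)
    case 0
    then show ?case using f(1)[of 0] by (subst (asm) f_eq) (auto simp: P_def)
  next
    case (Suc n)
    then show ?case by (simp add: f(2) g_def x_def)
  qed
  have xY: "x n \<in> Y" for n using f(1)[of n] by (subst (asm) f_eq) (simp add: P_def)
  have near: "\<phi> (x n) - (\<Sum>i<n. g i (x n)) \<le> \<phi> u - (\<Sum>i<n. g i u) + a n / 2" if "u \<in> Y" for n u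
    using f(1)[of n] that by (subst (asm) f_eq) (auto simp: P_def B)
  have g_nonneg: "0 \<le> g n u" for n u using a_pos[of n] b(2) by (simp add: g_def \<gamma>_def)
  have g_le: "g n u \<le> w n" for n u
  proof -
    have "g n u \<le> a n * 1" unfolding g_def \<gamma>_def using a_pos[of n] b(3) by (intro mult_left_mono) auto
    then show ?thesis using a_le[of n] by simp
  qed
  have g_lip: "\<bar>g n u - g n v\<bar> \<le> w n * norm (u - v)" for n u v
  proof -
    have "\<bar>g n u - g n v\<bar> = a n * \<bar>b (s n *\<^sub>R (u - x n)) - b (s n *\<^sub>R (v - x n))\<bar>"
      using a_pos[of n] by (simp add: g_def \<gamma>_def abs_mult flip: right_diff_distrib)
    also have "\<dots> \<le> a n * (L * norm (s n *\<^sub>R (u - x n) - s n *\<^sub>R (v - x n)))"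
      using a_pos[of n] b(4) by (intro mult_left_mono) auto
    also have "s n *\<^sub>R (u - x n) - s n *\<^sub>R (v - x n) = s n *\<^sub>R (u - v)" by (simp add: algebra_simps)
    also have "a n * (L * norm (s n *\<^sub>R (u - v))) = (a n * (L * s n)) * norm (u - v)" using s_pos[of n] by simp
    also have "\<dots> \<le> w n * norm (u - v)" using a_L by (intro mult_right_mono) auto
    finally show ?thesis .
  qed
  have g_far: "g n u = 0" if "norm (u - x n) \<ge> (1/2) ^ n" for n u
  proof -
    have "R = s n * (1/2) ^ n" by (simp add: s_def power_divide)
    also have "\<dots> \<le> s n * norm (u - x n)" using that s_pos[of n] by (intro mult_left_mono) auto
    also have "\<dots> = norm (s n *\<^sub>R (u - x n))" using s_pos[of n] by simp
    finally show ?thesis using b(5) by (simp add: g_def \<gamma>_def)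
  qed
  \<comment> \<open>Off the support of bump \<open>n\<close>, the point \<open>x (Suc n)\<close>
    would miss the gain \<open>a n\<close> available at \<open>x n\<close>, but the two tolerances
    are only \<open>a n / 2\<close> and \<open>a (Suc n) / 2 = a n / 8\<close>.\<close>
  have close: "norm (x (Suc n) - x n) < (1/2) ^ n" for n
  proof (rule ccontr)
    assume "\<not> ?thesis"
    then have "g n (x (Suc n)) = 0" by (intro g_far) simp
    moreover have "g n (x n) = a n" using b(1) by (simp add: g_def \<gamma>_def)
    ultimately show False
      using near[OF xY, of n "Suc n"] near[OF xY, of "Suc n" n] a_Suc[of n] a_pos[of n] by simp
  qed
  have "summable (\<lambda>n. x (Suc n) - x n)"
    by (rule summable_comparison_test'[of "\<lambda>n. (1/2::real) ^ n"])
      (auto intro!: summable_geometric less_imp_le[OF close])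
  then have "convergent (\<lambda>n. x n - x 0)"
    by (simp add: summable_iff_convergent sum_lessThan_telescope)
  then obtain l where "(\<lambda>n. x n - x 0) \<longlonglongrightarrow> l" by (auto simp: convergent_def)
  from tendsto_add[OF this tendsto_const[of "x 0"]] have lim: "x \<longlonglongrightarrow> l + x 0" by simp
  define p where "p = l + x 0"
  have lim: "x \<longlonglongrightarrow> p" using lim by (simp add: p_def)
  have pY: "p \<in> Y" using closed_sequentially[OF Y(2) xY lim] .
  define \<beta> where "\<beta> = (\<lambda>u. \<Sum>n. g n u)"
  have g_summable: "summable (\<lambda>n. g n u)" for u
    using g_nonneg g_le by (intro summable_comparison_test'[OF sums_summable[OF w_sums]]) simp
  have "\<phi> p - \<beta> p \<le> \<phi> u - \<beta> u" if u: "u \<in> Y" for u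
  proof (rule LIMSEQ_le)
    have "(\<lambda>n. \<phi> (x n)) \<longlonglongrightarrow> \<phi> p" using \<phi>(1) lim pY xY by (auto simp: continuous_on_sequentially o_def)
    moreover have "(\<lambda>n. norm (x n - p)) \<longlonglongrightarrow> 0" using lim by (simp add: LIM_zero_iff tendsto_norm_zero_iff)
    ultimately have "(\<lambda>n. \<phi> (x n) - (\<beta> p + \<epsilon> * norm (x n - p))) \<longlonglongrightarrow> \<phi> p - (\<beta> p + \<epsilon> * 0)"
      by (intro tendsto_intros)
    then show "(\<lambda>n. \<phi> (x n) - (\<beta> p + \<epsilon> * norm (x n - p))) \<longlonglongrightarrow> \<phi> p - \<beta> p" by simp
    have "(\<lambda>n. \<Sum>i<n. g i u) \<longlonglongrightarrow> \<beta> u" unfolding \<beta>_def using g_summable by (rule summable_LIMSEQ)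
    moreover have "w \<longlonglongrightarrow> 0" using w_sums by (intro summable_LIMSEQ_zero sums_summable)
    ultimately have "(\<lambda>n. \<phi> u - (\<Sum>i<n. g i u) + w n) \<longlonglongrightarrow> \<phi> u - \<beta> u + 0" by (intro tendsto_intros)
    then show "(\<lambda>n. \<phi> u - (\<Sum>i<n. g i u) + w n) \<longlonglongrightarrow> \<phi> u - \<beta> u" by simp
    \<comment> \<open>The partial sum at the moving point \<open>x n\<close> is first exchanged for
      \<open>\<beta> p\<close>, at a cost of \<open>\<epsilon> * norm (x n - p)\<close> that comes
      from the Lipschitz constants \<open>w i\<close>.\<close>
    have "\<phi> (x n) - (\<beta> p + \<epsilon> * norm (x n - p)) \<le> \<phi> u - (\<Sum>i<n. g i u) + w n" for n
    proof -
      have "(\<Sum>i<n. g i (x n)) \<le> (\<Sum>i<n. g i p + w i * norm (x n - p))"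
        using g_lip[of _ "x n" p] by (intro sum_mono) (simp add: abs_le_iff algebra_simps)
      also have "\<dots> = (\<Sum>i<n. g i p) + (\<Sum>i<n. w i) * norm (x n - p)"
        by (simp add: sum.distrib sum_distrib_right)
      also have "\<dots> \<le> \<beta> p + \<epsilon> * norm (x n - p)"
      proof (intro add_mono mult_right_mono)
        show "(\<Sum>i<n. g i p) \<le> \<beta> p" unfolding \<beta>_def using g_summable g_nonneg by (intro sum_le_suminf) auto
        show "(\<Sum>i<n. w i) \<le> \<epsilon>" using sum_le_suminf[OF sums_summable[OF w_sums], of "{..<n}"] w_pos w_sums
          by (simp add: sums_iff)
      qed simp
      finally show ?thesis using near[OF u, of n] a_le[of n] a_pos[of n] by linarith
    qed
    then show "\<exists>N. \<forall>n\<ge>N. \<phi> (x n) - (\<beta> p + \<epsilon> * norm (x n - p)) \<le> \<phi> u - (\<Sum>i<n. g i u) + w n" by blast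
  qed
  moreover have "0 \<le> \<beta> u" "\<beta> u \<le> \<epsilon>" for u
  proof -
    show "0 \<le> \<beta> u" unfolding \<beta>_def using g_summable g_nonneg by (intro suminf_nonneg) auto
    have "\<beta> u \<le> (\<Sum>n. w n)" unfolding \<beta>_def using g_summable sums_summable[OF w_sums] g_le by (intro suminf_le) auto
    then show "\<beta> u \<le> \<epsilon>" using w_sums by (simp add: sums_iff)
  qed
  moreover have "\<exists>D. (\<beta> has_derivative D) (at p within Y) \<and> (\<forall>h. \<bar>D h\<bar> \<le> \<epsilon> * norm h)"
  proof -
    obtain Db where Db: "\<And>u h. u \<in> Y \<Longrightarrow> \<bar>Db u h\<bar> \<le> L * norm h"
      "\<And>u. u \<in> Y \<Longrightarrow> (b has_derivative Db u) (at u within Y)"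
      using b_deriv by metis
    define G where "G = (\<lambda>n u h. a n * Db (s n *\<^sub>R (u - x n)) (s n *\<^sub>R h))"
    have inY: "s n *\<^sub>R (u - x n) \<in> Y" if "u \<in> Y" for n u
      using that xY Y(1) by (intro subspace_scale subspace_diff)
    have G_deriv: "(g n has_derivative G n u) (at u within Y)" if u: "u \<in> Y" for n u
    proof -
      have "((\<lambda>u. s n *\<^sub>R (u - x n)) has_derivative (\<lambda>h. s n *\<^sub>R h)) (at u within Y)"
        by (auto intro!: derivative_eq_intros)
      moreover have "(b has_derivative Db (s n *\<^sub>R (u - x n))) (at (s n *\<^sub>R (u - x n)) within (\<lambda>u. s n *\<^sub>R (u - x n)) ` Y)"
        using inY by (intro has_derivative_subset[OF Db(2)[OF inY[OF u]]]) auto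
      ultimately have "((\<lambda>u. b (s n *\<^sub>R (u - x n))) has_derivative (\<lambda>h. Db (s n *\<^sub>R (u - x n)) (s n *\<^sub>R h))) (at u within Y)"
        by (rule has_derivative_in_compose)
      then show ?thesis unfolding g_def \<gamma>_def G_def by (rule has_derivative_mult_right)
    qed
    have G_le: "\<bar>G n u h\<bar> \<le> w n * norm h" if u: "u \<in> Y" for n u h
    proof -
      have "\<bar>G n u h\<bar> = a n * \<bar>Db (s n *\<^sub>R (u - x n)) (s n *\<^sub>R h)\<bar>" using a_pos[of n] by (simp add: G_def abs_mult)
      also have "\<dots> \<le> a n * (L * norm (s n *\<^sub>R h))" using Db(1)[OF inY[OF u]] a_pos[of n]
        by (intro mult_left_mono) (auto simp del: norm_scaleR)
      also have "\<dots> = (a n * (L * s n)) * norm h" using s_pos[of n] by simp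
      also have "\<dots> \<le> w n * norm h" using a_L by (intro mult_right_mono) auto
      finally show ?thesis .
    qed
    have w_summable: "summable (\<lambda>n. w n * norm h)" for h :: 'a using w_sums by (intro summable_mult2 sums_summable)
    have G_summable: "summable (\<lambda>n. G n u h)" if "u \<in> Y" for u h
      using G_le[OF that] by (intro summable_comparison_test'[OF w_summable[of h]]) simp
    define G' where "G' = (\<lambda>u h. \<Sum>n. G n u h)"
    \<comment> \<open>Uniform control of the tails permits termwise differentiation; the case
      \<open>n = 0\<close> later bounds the derivative of \<beta> itself.\<close>
    have tail: "\<bar>(\<Sum>i<n. G i u h) - G' u h\<bar> \<le> \<epsilon> * (1/2) ^ n * norm h" if u: "u \<in> Y" for n u h
    proof -
      have "(\<Sum>i<n. G i u h) - G' u h = - (\<Sum>i. G (i + n) u h)"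
        unfolding G'_def using suminf_split_initial_segment[OF G_summable[OF u], of h n] by simp
      also have "\<bar>\<dots>\<bar> \<le> (\<Sum>i. w (i + n) * norm h)"
      proof -
        have "norm (\<Sum>i. G (i + n) u h) \<le> (\<Sum>i. w (i + n) * norm h)"
        proof (rule order_trans[OF summable_norm])
          have "summable (\<lambda>i. w (i + n) * norm h)" by (rule summable_ignore_initial_segment[OF w_summable])
          moreover from this show "summable (\<lambda>i. norm (G (i + n) u h))"
            by (rule summable_comparison_test') (use G_le[OF u] in simp)
          ultimately show "(\<Sum>i. norm (G (i + n) u h)) \<le> (\<Sum>i. w (i + n) * norm h)"
            using G_le[OF u] by (intro suminf_le) auto
        qed
        then show ?thesis by simp
      qed
      also have "(\<lambda>i. w (i + n) * norm h) = (\<lambda>i. (1/2) ^ n * norm h * w i)"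
        by (simp add: w_def power_add mult_ac fun_eq_iff)
      also have "(\<Sum>i. (1/2) ^ n * norm h * w i) = \<epsilon> * (1/2) ^ n * norm h"
        using w_sums by (subst suminf_mult) (auto simp: sums_iff)
      finally show ?thesis .
    qed
    have "\<exists>q. \<forall>u\<in>Y. (\<lambda>n. g n u) sums q u \<and> (q has_derivative G' u) (at u within Y)"
    proof (rule has_derivative_series)
      show "convex Y" using Y(1) by (rule subspace_imp_convex)
      show "(g n has_derivative G n u) (at u within Y)" if "u \<in> Y" for n u using that by (rule G_deriv)
      show "p \<in> Y" by (rule pY)
      show "(\<lambda>n. g n p) sums \<beta> p" unfolding \<beta>_def by (rule summable_sums[OF g_summable])
      fix e :: real assume "e > 0"
      have "(\<lambda>n. \<epsilon> * (1/2::real) ^ n) \<longlonglongrightarrow> \<epsilon> * 0" by (intro tendsto_intros LIMSEQ_power_zero) simp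
      then have "\<forall>\<^sub>F n in sequentially. \<epsilon> * (1/2) ^ n < e" using \<open>e > 0\<close> by (intro order_tendstoD(2)) auto
      then show "\<forall>\<^sub>F n in sequentially. \<forall>u\<in>Y. \<forall>h. norm ((\<Sum>i<n. G i u h) - G' u h) \<le> e * norm h"
      proof eventually_elim
        case (elim n)
        then have "\<epsilon> * (1/2) ^ n * norm h \<le> e * norm h" for h :: 'a by (intro mult_right_mono) auto
        then show ?case
          by (intro ballI allI order_trans[OF tail[where n = n, folded real_norm_def]])
      qed
    qed
    then obtain q where q: "\<And>u. u \<in> Y \<Longrightarrow> (\<lambda>n. g n u) sums q u" "(q has_derivative G' p) (at p within Y)"
      using pY by blast
    then have "(\<beta> has_derivative G' p) (at p within Y)"
      using pY by (intro has_derivative_transform[OF pY _ q(2)]) (auto simp: \<beta>_def sums_iff)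
    moreover have "\<bar>G' p h\<bar> \<le> \<epsilon> * norm h" for h using tail[OF pY, of h 0] by simp
    ultimately show ?thesis by blast
  qed
  ultimately show ?thesis using that pY by blast
qed

subsection \<open>Separable reduction\<close>

text \<open>\<open>D\<close> lives on the whole space, but only increments that stay in
  \<open>Y\<close> are tested. In this form the condition splits into families of linear
  inequalities on \<open>D\<close>, one family for each accuracy.\<close>

definition frechet_subgradient_within ::
    "'a::real_normed_vector set \<Rightarrow> ('a \<Rightarrow> real) \<Rightarrow> 'a \<Rightarrow> ('a \<Rightarrow> real) \<Rightarrow> bool" where
  "frechet_subgradient_within Y g x D \<longleftrightarrow> bounded_linear D \<and>
     (\<forall>e>0. \<exists>d>0. \<forall>h. x + h \<in> Y \<longrightarrow> norm h \<le> d \<longrightarrow> D h \<le> g (x + h) - g x + e * norm h)"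

text \<open>A list of triples \<open>(t, n, h)\<close> encodes a nonnegative combination of the constraints
  \<open>D h \<le> g (x + h) - g x + \<parallel>h\<parallel> / (n + 1)\<close> on a subgradient \<open>D\<close> of \<open>g\<close> at \<open>x\<close>.\<close>

definition cost :: "('a::real_normed_vector \<Rightarrow> real) \<Rightarrow> 'a \<Rightarrow> (real \<times> nat \<times> 'a) list \<Rightarrow> real" where
  "cost g x ys = (\<Sum>(t, n, h)\<leftarrow>ys. t * (g (x + h) - g x + norm h / Suc n))"

definition comb :: "(real \<times> nat \<times> 'a) list \<Rightarrow> 'a::real_normed_vector" where
  "comb ys = (\<Sum>(t, n, h)\<leftarrow>ys. t *\<^sub>R h)"

text \<open>\<open>\<delta> n\<close> codes the radius \<open>1 / (\<delta> n + 1)\<close> within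
  which accuracy \<open>1 / (n + 1)\<close> is demanded. With natural numbers as codes there are
  only countably many finite lists of radii.\<close>

definition admissible :: "(nat \<Rightarrow> nat) \<Rightarrow> (real \<times> nat \<times> 'a::real_normed_vector) list \<Rightarrow> bool" where
  "admissible \<delta> ys \<longleftrightarrow> (\<forall>(t, n, h)\<in>set ys. 0 \<le> t \<and> norm h \<le> 1 / Suc (\<delta> n))"

lemma cost_simps [simp]:
  "cost g x [] = 0" "cost g x ((t, n, h) # ys) = t * (g (x + h) - g x + norm h / Suc n) + cost g x ys"
  "cost g x (ys @ zs) = cost g x ys + cost g x zs"
  by (simp_all add: cost_def)

lemma comb_simps [simp]:
  "comb [] = 0" "comb ((t, n, h) # ys) = t *\<^sub>R h + comb ys" "comb (ys @ zs) = comb ys + comb zs"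
  by (simp_all add: comb_def)

lemma admissible_simps [simp]:
  "admissible \<delta> []" "admissible \<delta> ((t, n, h) # ys) \<longleftrightarrow> 0 \<le> t \<and> norm h \<le> 1 / Suc (\<delta> n) \<and> admissible \<delta> ys"
  "admissible \<delta> (ys @ zs) \<longleftrightarrow> admissible \<delta> ys \<and> admissible \<delta> zs"
  by (auto simp: admissible_def ball_Un)

definition rescale :: "real \<Rightarrow> (real \<times> nat \<times> 'a) list \<Rightarrow> (real \<times> nat \<times> 'a) list" where
  "rescale r = map (\<lambda>(t, n, h). (r * t, n, h))"

lemma rescale:
  "cost g x (rescale r ys) = r * cost g x ys" "comb (rescale r ys) = r *\<^sub>R comb ys"
  "0 \<le> r \<Longrightarrow> admissible \<delta> ys \<Longrightarrow> admissible \<delta> (rescale r ys)"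
  by (induction ys) (auto simp: rescale_def algebra_simps)

text \<open>\<open>p\<close> is the largest sublinear functional that lies below
  \<open>K * norm\<close> and below the right-hand side of every constraint and satisfies
  \<open>p (- e) \<le> - s\<close>. A linear functional below it is the required subgradient. The
  assumption \<open>nonneg\<close> keeps the infimum finite.\<close>

lemma asplund_subgradient_exists:
  fixes g :: "'a::banach \<Rightarrow> real"
  assumes "asplund_space TYPE('a)" "K \<ge> 0"
    and nonneg: "\<And>ys t. admissible \<delta> ys \<Longrightarrow> 0 \<le> t \<Longrightarrow> 0 \<le> cost g x ys - t * s + K * norm (comb ys - t *\<^sub>R e)"
  obtains D where "frechet_subgradient_within UNIV g x D" "D e \<ge> s"
proof -
  define A where "A = {(ys :: (real \<times> nat \<times> 'a) list, t). admissible \<delta> ys \<and> 0 \<le> (t::real)}"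
  define F where "F = (\<lambda>w (ys, t). cost g x ys - t * s + K * norm (w - (comb ys - t *\<^sub>R e)))"
  define p where "p = (\<lambda>w. INF a\<in>A. F w a)"
  have mem: "(ys, t) \<in> A \<longleftrightarrow> admissible \<delta> ys \<and> 0 \<le> t" for ys t by (simp add: A_def)
  have "A \<noteq> {}" using mem[of "[]" 0] by auto
  have low: "- (K * norm w) \<le> F w a" if "a \<in> A" for w a
  proof (cases a)
    case (Pair ys t)
    have "norm (comb ys - t *\<^sub>R e) \<le> norm w + norm (w - (comb ys - t *\<^sub>R e))"
      using norm_triangle_sub[of "comb ys - t *\<^sub>R e" w] by (simp add: norm_minus_commute)
    then have "K * norm (comb ys - t *\<^sub>R e) \<le> K * (norm w + norm (w - (comb ys - t *\<^sub>R e)))"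
      using \<open>K \<ge> 0\<close> by (rule mult_left_mono)
    with nonneg[of ys t] that show ?thesis unfolding Pair F_def by (simp add: mem algebra_simps)
  qed
  have bdd: "bdd_below (F w ` A)" for w using low by (rule bdd_belowI2)
  have p_le: "p w \<le> F w a" if "a \<in> A" for w a unfolding p_def using bdd that by (rule cINF_lower)
  have p_ge: "c \<le> p w" if "\<And>a. a \<in> A \<Longrightarrow> c \<le> F w a" for c w
    unfolding p_def using \<open>A \<noteq> {}\<close> that by (rule cINF_greatest)
  have add: "p (v + w) \<le> p v + p w" for v w
  proof -
    have "p (v + w) \<le> F v a + F w b" if "a \<in> A" "b \<in> A" for a b
    proof (cases a; cases b)
      fix ys t ys' t' assume ab: "a = (ys, t)" "b = (ys', t')"
      have "norm (v + w - (comb (ys @ ys') - (t + t') *\<^sub>R e))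
          \<le> norm (v - (comb ys - t *\<^sub>R e)) + norm (w - (comb ys' - t' *\<^sub>R e))"
        using norm_triangle_ineq[of "v - (comb ys - t *\<^sub>R e)" "w - (comb ys' - t' *\<^sub>R e)"]
        by (simp add: algebra_simps)
      then have "K * norm (v + w - (comb (ys @ ys') - (t + t') *\<^sub>R e))
          \<le> K * (norm (v - (comb ys - t *\<^sub>R e)) + norm (w - (comb ys' - t' *\<^sub>R e)))"
        using \<open>K \<ge> 0\<close> by (rule mult_left_mono)
      moreover have "(ys @ ys', t + t') \<in> A" using that ab by (simp add: mem)
      ultimately show ?thesis
        using p_le[of "(ys @ ys', t + t')" "v + w"] unfolding ab F_def
        by (simp add: distrib_left distrib_right del: comb_simps)
    qed
    then have "p (v + w) - F w b \<le> F v a" if "a \<in> A" "b \<in> A" for a b using that by (simp add: diff_le_eq)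
    then have "p (v + w) - F w b \<le> p v" if "b \<in> A" for b using that by (intro p_ge)
    then have "p (v + w) - p v \<le> F w b" if "b \<in> A" for b using that by (simp add: algebra_simps)
    then have "p (v + w) - p v \<le> p w" by (intro p_ge)
    then show ?thesis by simp
  qed
  have scale_le: "p (r *\<^sub>R w) \<le> r * p w" if "r > 0" for r w
  proof -
    have "p (r *\<^sub>R w) / r \<le> F w a" if "a \<in> A" for a
    proof (cases a)
      case (Pair ys t)
      then have "(rescale r ys, r * t) \<in> A" using that \<open>r > 0\<close> by (simp add: mem rescale)
      then have "p (r *\<^sub>R w) \<le> F (r *\<^sub>R w) (rescale r ys, r * t)" by (rule p_le)
      also have "\<dots> = r * (cost g x ys - t * s) + K * norm (r *\<^sub>R (w - (comb ys - t *\<^sub>R e)))"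
        unfolding F_def by (simp add: rescale algebra_simps)
      also have "\<dots> = r * F w a" using \<open>r > 0\<close> unfolding Pair F_def norm_scaleR by (simp add: distrib_left right_diff_distrib)
      finally show ?thesis using \<open>r > 0\<close> by (simp add: divide_le_eq mult.commute)
    qed
    then have "p (r *\<^sub>R w) / r \<le> p w" by (rule p_ge)
    then show ?thesis using \<open>r > 0\<close> by (simp add: divide_le_eq mult.commute)
  qed
  have scale: "p (r *\<^sub>R w) = r * p w" if "r > 0" for r w
  proof (rule antisym[OF scale_le[OF that]])
    have "p ((1 / r) *\<^sub>R (r *\<^sub>R w)) \<le> (1 / r) * p (r *\<^sub>R w)" using that by (intro scale_le) simp
    then show "r * p w \<le> p (r *\<^sub>R w)" using that by (simp add: field_simps)
  qed
  have bound: "p w \<le> K * norm w" for w using p_le[of "([], 0)" w] by (simp add: mem F_def)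
  have "\<exists>D. bounded_linear D \<and> (\<forall>h. D h \<le> p h)"
    by (rule asplund_linear_minorant[OF assms(1) open_UNIV UNIV_not_empty add scale bound]) auto
  then obtain D where D: "bounded_linear D" "\<And>h. D h \<le> p h" by blast
  have "\<exists>d>0. \<forall>h. x + h \<in> UNIV \<longrightarrow> norm h \<le> d \<longrightarrow> D h \<le> g (x + h) - g x + \<epsilon> * norm h" if pos: "\<epsilon> > 0" for \<epsilon>
  proof -
    obtain n where n: "inverse (Suc n) < \<epsilon>" using reals_Archimedean[OF pos] by blast
    have "D h \<le> g (x + h) - g x + \<epsilon> * norm h" if h: "norm h \<le> 1 / Suc (\<delta> n)" for h
    proof -
      \<comment> \<open>A one-element list recovers a single constraint; the empty list with
        \<open>t = 1\<close> will give \<open>D e \<ge> s\<close>.\<close>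
      have "D h \<le> F h ([(1, n, h)], 0)" using D(2)[of h] p_le[of "([(1, n, h)], 0)" h] h by (simp add: mem)
      also have "\<dots> = g (x + h) - g x + inverse (Suc n) * norm h"
        by (simp add: F_def divide_inverse mult.commute)
      also have "\<dots> \<le> g (x + h) - g x + \<epsilon> * norm h" using n by (intro add_left_mono mult_right_mono) auto
      finally show ?thesis .
    qed
    then show ?thesis by (intro exI[of _ "1 / Suc (\<delta> n)"]) simp
  qed
  then have "frechet_subgradient_within UNIV g x D" using D(1) by (simp add: frechet_subgradient_within_def)
  moreover have "D (- e) \<le> - s" using D(2)[of "- e"] p_le[of "([], 1)" "- e"] by (simp add: mem F_def)
  then have "D e \<ge> s" using linear_neg[OF bounded_linear.linear[OF D(1)], of e] by simp
  ultimately show ?thesis by (rule that)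
qed

lemma countable_closure_under:
  fixes \<Phi> :: "'i::countable \<Rightarrow> 'a \<Rightarrow> 'a \<Rightarrow> 'a set"
  assumes "countable S" "\<And>i x y. countable (\<Phi> i x y)"
  shows "\<exists>C. countable C \<and> S \<subseteq> C \<and> (\<forall>i. \<forall>x\<in>C. \<forall>y\<in>C. \<Phi> i x y \<subseteq> C)"
proof -
  define step where "step = (\<lambda>A. A \<union> (\<Union>i. \<Union>x\<in>A. \<Union>y\<in>A. \<Phi> i x y))"
  define T where "T = (\<lambda>n. (step ^^ n) S)"
  have T_Suc: "T (Suc n) = T n \<union> (\<Union>i. \<Union>x\<in>T n. \<Union>y\<in>T n. \<Phi> i x y)" for n by (simp add: T_def step_def)
  have "countable (T n)" for n
  proof (induction n)
    case 0
    then show ?case using assms(1) by (simp add: T_def)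
  next
    case (Suc n)
    then show ?case unfolding T_Suc using assms(2) by (intro countable_Un countable_UN) auto
  qed
  moreover have "T 0 = S" by (simp add: T_def)
  moreover have mono: "T m \<subseteq> T n" if "m \<le> n" for m n
    using that by (rule lift_Suc_mono_le[rotated]) (simp add: T_Suc)
  have "\<Phi> i x y \<subseteq> (\<Union>n. T n)" if xy: "x \<in> (\<Union>n. T n)" "y \<in> (\<Union>n. T n)" for i x y
  proof -
    obtain m n where "x \<in> T m" "y \<in> T n" using xy by blast
    then have "x \<in> T (max m n)" "y \<in> T (max m n)" using mono[of m "max m n"] mono[of n "max m n"] by auto
    then have "\<Phi> i x y \<subseteq> T (Suc (max m n))" unfolding T_Suc by blast
    then show ?thesis by blast
  qed
  ultimately show ?thesis by (intro exI[of _ "\<Union>n. T n"]) auto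
qed

text \<open>Each variable is extended from \<open>C\<close>, or from the rationals, separately: its
  set of good values is closed.\<close>

lemma subspace_closure_rational:
  fixes C :: "'a::real_normed_vector set"
  assumes "C \<noteq> {}" and comb: "\<And>q r x y. q \<in> \<rat> \<Longrightarrow> r \<in> \<rat> \<Longrightarrow> x \<in> C \<Longrightarrow> y \<in> C \<Longrightarrow> q *\<^sub>R x + r *\<^sub>R y \<in> C"
  shows "subspace (closure C)"
proof (rule subspaceI)
  have scale_mem: "r *\<^sub>R x \<in> C" if "r \<in> \<rat>" "x \<in> C" for r x using comb[of r 0 x x] that by simp
  obtain x where "x \<in> C" using assms(1) by blast
  then show "0 \<in> closure C" using scale_mem[of 0 x] closure_subset by auto
  have add1: "x + y \<in> closure C" if x: "x \<in> C" and y: "y \<in> closure C" for x y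
  proof -
    have "closed ((\<lambda>y. x + y) -` closure C)" by (intro closed_vimage continuous_intros closed_closure)
    moreover have "C \<subseteq> (\<lambda>y. x + y) -` closure C" using comb[of 1 1 x] x closure_subset by auto
    ultimately show ?thesis using y closure_minimal by blast
  qed
  show "x + y \<in> closure C" if x: "x \<in> closure C" and y: "y \<in> closure C" for x y
  proof -
    have "closed ((\<lambda>x. x + y) -` closure C)" by (intro closed_vimage continuous_intros closed_closure)
    moreover have "C \<subseteq> (\<lambda>x. x + y) -` closure C" using add1 y by auto
    ultimately show ?thesis using x closure_minimal by blast
  qed
  have scale1: "r *\<^sub>R x \<in> closure C" if x: "x \<in> C" for r x
  proof -
    have "closed ((\<lambda>r. r *\<^sub>R x) -` closure C)" by (intro closed_vimage continuous_intros closed_closure)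
    moreover have "\<rat> \<subseteq> (\<lambda>r. r *\<^sub>R x) -` closure C" using scale_mem[OF _ x] by (auto intro: subsetD[OF closure_subset])
    ultimately have "closure \<rat> \<subseteq> (\<lambda>r. r *\<^sub>R x) -` closure C" by (intro closure_minimal)
    then show ?thesis by (auto simp: Rats_closure_real)
  qed
  show "r *\<^sub>R x \<in> closure C" if x: "x \<in> closure C" for r x
  proof -
    have "closed ((\<lambda>x. r *\<^sub>R x) -` closure C)" by (intro closed_vimage continuous_intros closed_closure)
    moreover have "C \<subseteq> (\<lambda>x. r *\<^sub>R x) -` closure C" using scale1 by auto
    ultimately show ?thesis using x closure_minimal by blast
  qed
qed

text \<open>Non-existence of a subgradient with \<open>D e \<ge> s\<close> at \<open>x\<close> is witnessed, for each choice of the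
  radii, by a finite violating combination. The witness depends on finitely many radii only and
  survives small perturbations of \<open>x\<close>, so countably many witnesses suffice.\<close>

lemma separable_reduction:
  fixes g :: "'a::banach \<Rightarrow> real"
  assumes asp: "asplund_space TYPE('a)" and lip: "\<And>u v. \<bar>g u - g v\<bar> \<le> l * norm (u - v)"
    and S: "countable S" "S \<noteq> {}"
  obtains c :: "nat \<Rightarrow> 'a" where "S \<subseteq> range c" "subspace (closure (range c))"
    "\<And>x D. x \<in> closure (range c) \<Longrightarrow> frechet_subgradient_within (closure (range c)) g x D \<Longrightarrow> D e \<ge> s \<Longrightarrow>
       \<exists>D'. frechet_subgradient_within UNIV g x D' \<and> D' e \<ge> s"
proof -
  \<comment> \<open>\<open>dl\<close> lists finitely many radii, \<open>K\<close> bounds the norm of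
    the functional, and \<open>N\<close> serves twice: as a bound on the total weight and, through
    \<open>1 / (N + 1)\<close>, as a safety margin. Both make a violation survive a small move of
    the base point.\<close>
  define viol where "viol = (\<lambda>c (dl, K, N) (ys, t).
    (\<forall>(t, n, h)\<in>set ys. 0 \<le> t \<and> n < length dl \<and> norm h \<le> 1 / Suc (dl ! n)) \<and> 0 \<le> t \<and>
    sum_list (map fst ys) \<le> real N \<and>
    cost g c ys - t * s + real K * norm (comb ys - t *\<^sub>R e) < - (1 / Suc N))"
  define wit where "wit = (\<lambda>c d. (SOME a. viol c d a))"
  \<comment> \<open>The index type is countable, so closing under \<Phi> preserves countability.
    Besides rational combinations, the vectors of the witness chosen at \<open>x\<close> are added;
    if nothing is violated there, the choice is arbitrary but still a finite list.\<close>
  define \<Phi> :: "(nat list \<times> nat \<times> nat) \<times> rat \<times> rat \<Rightarrow> 'a \<Rightarrow> 'a \<Rightarrow> 'a set" where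
    "\<Phi> = (\<lambda>(d, q, r) x y. insert (of_rat q *\<^sub>R x + of_rat r *\<^sub>R y) (snd ` snd ` set (fst (wit x d))))"
  have "countable (\<Phi> i x y)" for i x y by (cases i) (auto simp: \<Phi>_def intro: countable_finite)
  from countable_closure_under[OF S(1) this] obtain C where C0: "countable C \<and> S \<subseteq> C \<and>
      (\<forall>i. \<forall>x\<in>C. \<forall>y\<in>C. \<Phi> i x y \<subseteq> C)" ..
  then have C: "countable C" "S \<subseteq> C" by auto
  have C_closed: "\<Phi> i x y \<subseteq> C" if "x \<in> C" "y \<in> C" for i x y using C0 that by blast
  have "C \<noteq> {}" using C(2) S(2) by blast
  have rat: "q *\<^sub>R x + r *\<^sub>R y \<in> C" if qr: "q \<in> \<rat>" "r \<in> \<rat>" and xy: "x \<in> C" "y \<in> C" for q r x y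
  proof -
    obtain q' r' where "q = of_rat q'" "r = of_rat r'" using qr by (auto elim!: Rats_cases)
    then show ?thesis using C_closed[OF xy, of "(([], 0, 0), q', r')"] by (simp add: \<Phi>_def)
  qed
  have wit_mem: "snd ` snd ` set (fst (wit x d)) \<subseteq> C" if "x \<in> C" for x d
    using C_closed[OF that that, of "(d, 0, 0)"] by (simp add: \<Phi>_def)
  have sub: "subspace (closure C)" using \<open>C \<noteq> {}\<close> rat by (rule subspace_closure_rational)
  define c where "c = from_nat_into C"
  have range: "range c = C" unfolding c_def using \<open>C \<noteq> {}\<close> C(1) by (rule range_from_nat_into)
  have cost_near: "cost g v ys \<le> cost g u ys + sum_list (map fst ys) * (2 * (l * norm (u - v)))"
    if "\<forall>(t, n, h)\<in>set ys. 0 \<le> t" for u v ys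
    using that
  proof (induction ys)
    case (Cons y ys)
    obtain t n h where y: "y = (t, n, h)" by (cases y)
    have "g (v + h) - g v \<le> g (u + h) - g u + 2 * (l * norm (u - v))"
      using lip[of "u + h" "v + h"] lip[of u v] by (simp add: abs_le_iff)
    then have "t * (g (v + h) - g v) \<le> t * (g (u + h) - g u + 2 * (l * norm (u - v)))"
      using Cons.prems by (intro mult_left_mono) (auto simp: y)
    with Cons show ?case by (simp add: y algebra_simps)
  qed simp
  show ?thesis
  proof (rule that[of c]; unfold range)
    show "S \<subseteq> C" "subspace (closure C)" by (fact C(2), fact sub)
    fix x D assume x: "x \<in> closure C" and D: "frechet_subgradient_within (closure C) g x D" and De: "D e \<ge> s"
    have lin: "linear D" and blin: "bounded_linear D"
      using D by (auto simp: frechet_subgradient_within_def bounded_linear.linear)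
    obtain K' where K': "\<And>h. norm (D h) \<le> norm h * K'" using bounded_linear.bounded[OF blin] by blast
    obtain K :: nat where "K' \<le> K" using real_arch_simple by blast
    have K: "- D h \<le> K * norm h" for h
    proof -
      have "norm h * K' \<le> norm h * K" using \<open>K' \<le> K\<close> by (intro mult_left_mono) auto
      then show ?thesis using K'[of h] by (simp add: mult.commute)
    qed
    have "\<exists>d::nat. \<forall>h. x + h \<in> closure C \<longrightarrow> norm h \<le> 1 / Suc d \<longrightarrow> D h \<le> g (x + h) - g x + norm h / Suc n" for n
    proof -
      obtain d where d: "d > 0" "\<And>h. x + h \<in> closure C \<Longrightarrow> norm h \<le> d \<Longrightarrow> D h \<le> g (x + h) - g x + inverse (Suc n) * norm h"
        using D unfolding frechet_subgradient_within_def by (metis inverse_positive_iff_positive of_nat_0_less_iff zero_less_Suc)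
      obtain k where "inverse (Suc k) < d" using d(1) reals_Archimedean by blast
      then show ?thesis using d(2) by (intro exI[of _ k]) (auto simp: divide_inverse mult.commute)
    qed
    then obtain \<delta> :: "nat \<Rightarrow> nat" where \<delta>: "\<And>n h. x + h \<in> closure C \<Longrightarrow> norm h \<le> 1 / Suc (\<delta> n) \<Longrightarrow>
        D h \<le> g (x + h) - g x + norm h / Suc n" by metis
    \<comment> \<open>A violation at \<open>x\<close> moves to a nearby \<open>c0\<close> in
      \<open>C\<close>, is exchanged there for the chosen witness, whose vectors lie in
      \<open>C\<close>, and moves back to \<open>x\<close>, where it contradicts the existence of
      \<open>D\<close>.\<close>
    have nonneg: "0 \<le> cost g x ys - t * s + real K * norm (comb ys - t *\<^sub>R e)" if adm: "admissible \<delta> ys" and "0 \<le> t" for ys t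
    proof (rule ccontr)
      assume neg: "\<not> ?thesis"
      define v where "v = - (cost g x ys - t * s + real K * norm (comb ys - t *\<^sub>R e))"
      have "v / 2 > 0" using neg by (simp add: v_def)
      then obtain N1 where N1: "inverse (Suc N1) < v / 2" using reals_Archimedean by blast
      obtain N2 :: nat where N2: "sum_list (map fst ys) \<le> real N2" using real_arch_simple by blast
      define N where "N = max N1 N2"
      have "inverse (real (Suc N)) \<le> inverse (real (Suc N1))" by (intro le_imp_inverse_le) (auto simp: N_def)
      then have N: "1 / Suc N < v / 2" "sum_list (map fst ys) \<le> real N"
        using N1 N2 by (simp_all only: inverse_eq_divide) (simp_all add: N_def)
      define m where "m = Suc (Max (insert 0 ((fst \<circ> snd) ` set ys)))"
      define dl where "dl = map \<delta> [0..<m]"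
      have m: "n < m" if "(t, n, h) \<in> set ys" for t n h
      proof -
        have "n \<in> insert 0 ((fst \<circ> snd) ` set ys)" using that by force
        then have "n \<le> Max (insert 0 ((fst \<circ> snd) ` set ys))" by (intro Max_ge) auto
        then show ?thesis by (simp add: m_def)
      qed
      have dl: "length dl = m" "\<And>n. n < m \<Longrightarrow> dl ! n = \<delta> n" by (auto simp: dl_def)
      \<comment> \<open>A move over distance \<open>r\<close> changes the cost of a list of weight
        at most \<open>N\<close> by at most \<open>1 / (N + 1)\<close>. As
        \<open>v > 2 / (N + 1)\<close>, the margin still holds at \<open>c0\<close> and then pays
        for the way back.\<close>
      define r where "r = 1 / Suc N / (2 * N * \<bar>l\<bar> + 1)"
      have "r > 0" by (simp add: r_def add_nonneg_pos)
      then obtain c0 where c0: "c0 \<in> C" "norm (x - c0) < r"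
        using x by (metis closure_approachable dist_norm norm_minus_commute)
      have small: "q * (2 * (l * norm (x - c0))) \<le> 1 / Suc N" if "0 \<le> q" "q \<le> N" for q :: real
      proof -
        have "l * norm (x - c0) \<le> \<bar>l\<bar> * norm (x - c0)" by (intro mult_right_mono) auto
        then have "q * (2 * (l * norm (x - c0))) \<le> q * (2 * (\<bar>l\<bar> * norm (x - c0)))"
          using that by (intro mult_left_mono) auto
        also have "\<dots> \<le> N * (2 * (\<bar>l\<bar> * norm (x - c0)))" using that by (intro mult_right_mono) auto
        also have "\<dots> = (2 * N * \<bar>l\<bar>) * norm (x - c0)" by simp
        also have "\<dots> \<le> (2 * N * \<bar>l\<bar> + 1) * r" using c0(2) by (intro mult_mono) auto
        also have "\<dots> = 1 / Suc N"
          unfolding r_def by (subst times_divide_eq_right, subst nonzero_mult_div_cancel_left) (auto simp: add_nonneg_eq_0_iff)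
        finally show ?thesis .
      qed
      have ys0: "\<forall>(t, n, h)\<in>set ys. 0 \<le> t" using adm by (auto simp: admissible_def)
      have "0 \<le> sum_list (map fst ys)" using ys0 by (intro sum_list_nonneg) auto
      then have "cost g c0 ys \<le> cost g x ys + 1 / Suc N"
        using cost_near[OF ys0, of c0 x] small[of "sum_list (map fst ys)"] N(2) by linarith
      then have "cost g c0 ys - t * s + real K * norm (comb ys - t *\<^sub>R e) < - (1 / Suc N)"
        using N(1) by (simp add: v_def)
      moreover have "\<forall>(t, n, h)\<in>set ys. 0 \<le> t \<and> n < length dl \<and> norm h \<le> 1 / Suc (dl ! n)"
        using adm m by (auto simp: admissible_def dl split: prod.splits)
      ultimately have "viol c0 (dl, K, N) (ys, t)" using N(2) \<open>0 \<le> t\<close> by (simp add: viol_def)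
      then have "viol c0 (dl, K, N) (wit c0 (dl, K, N))" unfolding wit_def by (rule someI)
      moreover obtain zs u where zs: "wit c0 (dl, K, N) = (zs, u)" by (cases "wit c0 (dl, K, N)")
      ultimately have viol: "\<forall>(t, n, h)\<in>set zs. 0 \<le> t \<and> n < m \<and> norm h \<le> 1 / Suc (\<delta> n)" "0 \<le> u"
        "sum_list (map fst zs) \<le> N" "cost g c0 zs - u * s + real K * norm (comb zs - u *\<^sub>R e) < - (1 / Suc N)"
        by (auto simp: viol_def dl)
      have zs0: "\<forall>(t, n, h)\<in>set zs. 0 \<le> t" using viol(1) by auto
      have "0 \<le> sum_list (map fst zs)" using zs0 by (intro sum_list_nonneg) auto
      then have "cost g x zs \<le> cost g c0 zs + 1 / Suc N"
        using cost_near[OF zs0, of x c0] small[of "sum_list (map fst zs)"] viol(3) by (simp add: norm_minus_commute)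
      with viol(4) have "cost g x zs - u * s + real K * norm (comb zs - u *\<^sub>R e) < 0" by linarith
      moreover have zsC: "snd ` snd ` set zs \<subseteq> C" using wit_mem[OF c0(1), of "(dl, K, N)"] by (simp add: zs)
      \<comment> \<open>\<open>D\<close> satisfies the constraints only for increments that stay in
        the closure of \<open>C\<close>; this is why the witness vectors had to be in
        \<open>C\<close>.\<close>
      have "D (comb zs) \<le> cost g x zs"
        using viol(1) zsC
      proof (induction zs)
        case Nil
        then show ?case using lin by (simp add: linear_0)
      next
        case (Cons z zs)
        obtain t n h where z: "z = (t, n, h)" by (cases z)
        have "x + h \<in> closure C" using Cons.prems(2) x sub closure_subset by (intro subspace_add) (auto simp: z)
        then have "D h \<le> g (x + h) - g x + norm h / Suc n" using Cons.prems(1) by (intro \<delta>) (auto simp: z)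
        then have "t * D h \<le> t * (g (x + h) - g x + norm h / Suc n)"
          using Cons.prems(1) by (intro mult_left_mono) (auto simp: z)
        moreover have "D (comb zs) \<le> cost g x zs" using Cons by auto
        ultimately show ?case using lin by (simp add: z linear_add linear_scale)
      qed
      moreover have "u * s \<le> u * D e" using De viol(2) by (rule mult_left_mono)
      moreover have "D (comb zs) - u * D e = D (comb zs - u *\<^sub>R e)" using lin by (simp add: linear_diff linear_scale)
      ultimately show False using K[of "comb zs - u *\<^sub>R e"] by linarith
    qed
    obtain D' where "frechet_subgradient_within UNIV g x D'" "D' e \<ge> s"
      by (rule asplund_subgradient_exists[OF asp of_nat_0_le_iff nonneg])
    then show "\<exists>D'. frechet_subgradient_within UNIV g x D' \<and> s \<le> D' e" by blast
  qed
qed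

subsection \<open>Mean value inequality\<close>

text \<open>Minimise \<open>g u - g a - t s + (l + 1) \<kappa> (u - a - t e)\<close> over \<open>u\<close> and \<open>t \<in> [0,1]\<close>, up to a small
  smooth perturbation in \<open>u\<close>. The value at \<open>t = 1\<close> is too large, so \<open>t\<close> can be increased at a
  minimum, and this bounds the derivative of \<open>\<kappa>\<close> in direction \<open>e\<close>.\<close>

lemma asplund_mean_value:
  fixes g :: "'a::banach \<Rightarrow> real"
  assumes asp: "asplund_space TYPE('a)" and lip: "\<And>u v. \<bar>g u - g v\<bar> \<le> l * norm (u - v)" and "l \<ge> 0"
    and gap: "g (a + e) - g a > s" and "\<eta> > 0"
  obtains x D where "frechet_subgradient_within UNIV g x D" "D e \<ge> s - \<eta> * norm e"
    "norm (x - a) \<le> (l + 1) * norm e + \<bar>s\<bar> + \<eta>"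
proof -
  obtain c :: "nat \<Rightarrow> 'a" where c: "{a, e} \<subseteq> range c" "subspace (closure (range c))"
    and reduce: "\<And>x D. x \<in> closure (range c) \<Longrightarrow> frechet_subgradient_within (closure (range c)) g x D \<Longrightarrow>
       D e \<ge> s - \<eta> * norm e \<Longrightarrow> \<exists>D'. frechet_subgradient_within UNIV g x D' \<and> D' e \<ge> s - \<eta> * norm e"
    using separable_reduction[where S = "{a, e}" and e = e and s = "s - \<eta> * norm e", OF asp lip] by auto
  define Y where "Y = closure (range c)"
  have Y: "subspace Y" "closed Y" and ae: "a \<in> Y" "e \<in> Y"
    using c closure_subset[of "range c"] by (auto simp: Y_def)
  show ?thesis
  proof (rule asplund_smooth_gauge[OF asp Y(1) Y_def])
    fix \<kappa> and R :: real
    assume \<kappa>: "R > 0" "\<kappa> 0 = (0::real)" "\<And>u. 0 \<le> \<kappa> u" "\<And>u v. \<bar>\<kappa> u - \<kappa> v\<bar> \<le> 2 * norm (u - v)"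
      "\<And>u. norm u \<ge> R \<Longrightarrow> norm u \<le> \<kappa> u"
      and \<kappa>_deriv: "\<And>u. u \<in> Y \<Longrightarrow> \<exists>D. (\<forall>h. \<bar>D h\<bar> \<le> 2 * norm h) \<and> (\<kappa> has_derivative D) (at u within Y)"
    obtain b where b: "b 0 = (1::real)" "\<And>u. 0 \<le> b u" "\<And>u. b u \<le> 1" "\<And>u v. \<bar>b u - b v\<bar> \<le> 4 * norm (u - v)"
      "\<And>u. norm u \<ge> max R 1 \<Longrightarrow> b u = 0"
      "\<And>u. u \<in> Y \<Longrightarrow> \<exists>D. (\<forall>h. \<bar>D h\<bar> \<le> 4 * norm h) \<and> (b has_derivative D) (at u within Y)"
      using smooth_bump[OF \<kappa>(2-5) \<kappa>_deriv] by blast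
    define \<gamma> where "\<gamma> = g (a + e) - g a - s"
    \<comment> \<open>With \<open>\<epsilon> \<le> \<gamma> / 3\<close>, the lower bound
      \<open>\<gamma> - \<epsilon>\<close> that \<open>t = 1\<close> would force exceeds the upper
      bound \<epsilon> on \<open>\<phi> x\<close>.\<close>
    define \<epsilon> where "\<epsilon> = min \<eta> (\<gamma> / 3)"
    have "\<gamma> > 0" using gap by (simp add: \<gamma>_def)
    then have \<epsilon>: "\<epsilon> > 0" "\<epsilon> \<le> \<eta>" "\<epsilon> \<le> \<gamma> / 3" using \<open>\<eta> > 0\<close> by (auto simp: \<epsilon>_def)
    \<comment> \<open>Rescaling by \<mu> keeps the Lipschitz constant 2 and lets the penalty
      dominate the norm already from radius \<open>\<mu> * R\<close> on, with
      \<open>(l + 1) * (\<mu> * R) = \<epsilon>\<close>.\<close>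
    define \<mu> where "\<mu> = \<epsilon> / ((l + 1) * R)"
    have \<mu>: "\<mu> > 0" "(l + 1) * (\<mu> * R) = \<epsilon>" using \<epsilon>(1) \<kappa>(1) \<open>l \<ge> 0\<close> by (auto simp: \<mu>_def)
    have "0 < \<mu> * R" using \<mu>(1) \<kappa>(1) by simp
    then have \<mu>R: "\<mu> * R \<le> \<epsilon>" "l * (\<mu> * R) \<le> \<epsilon>"
      using \<mu>(2) mult_nonneg_nonneg[OF \<open>l \<ge> 0\<close>, of "\<mu> * R"] by (auto simp: distrib_right)
    define k where "k = (\<lambda>u. \<mu> * \<kappa> ((1 / \<mu>) *\<^sub>R u))"
    have k0: "k 0 = 0" by (simp add: k_def \<kappa>(2))
    have k_nonneg: "0 \<le> k u" for u using \<mu>(1) \<kappa>(3) by (simp add: k_def)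
    have k_lip: "\<bar>k u - k v\<bar> \<le> 2 * norm (u - v)" for u v
    proof -
      have "\<bar>k u - k v\<bar> = \<mu> * \<bar>\<kappa> ((1 / \<mu>) *\<^sub>R u) - \<kappa> ((1 / \<mu>) *\<^sub>R v)\<bar>"
        using \<mu>(1) by (simp add: k_def abs_mult flip: right_diff_distrib)
      also have "\<dots> \<le> \<mu> * (2 * norm ((1 / \<mu>) *\<^sub>R u - (1 / \<mu>) *\<^sub>R v))"
        using \<mu>(1) \<kappa>(4) by (intro mult_left_mono) auto
      also have "\<dots> = 2 * norm (u - v)" using \<mu>(1) by (simp flip: scaleR_diff_right)
      finally show ?thesis .
    qed
    have k_far: "norm u \<le> k u" if "norm u \<ge> \<mu> * R" for u
    proof -
      have "norm ((1 / \<mu>) *\<^sub>R u) \<le> \<kappa> ((1 / \<mu>) *\<^sub>R u)" using that \<mu>(1) by (intro \<kappa>(5)) (simp add: field_simps)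
      then show ?thesis using \<mu>(1) by (simp add: k_def field_simps)
    qed
    have k_low: "l * norm w - \<epsilon> \<le> (l + 1) * k w" for w
    proof (cases "norm w \<ge> \<mu> * R")
      case True
      then have "l * norm w \<le> (l + 1) * k w" using k_far[OF True] \<open>l \<ge> 0\<close> by (intro mult_mono) auto
      then show ?thesis using \<epsilon>(1) by linarith
    next
      case False
      then have "l * norm w \<le> l * (\<mu> * R)" using \<open>l \<ge> 0\<close> by (intro mult_left_mono) auto
      moreover have "0 \<le> (l + 1) * k w" using k_nonneg \<open>l \<ge> 0\<close> by simp
      ultimately show ?thesis using \<mu>R(2) by linarith
    qed
    have k_deriv: "\<exists>D. (k has_derivative D) (at u within Y)" if "u \<in> Y" for u
    proof -
      have mem: "(1 / \<mu>) *\<^sub>R u \<in> Y" using that Y(1) by (intro subspace_scale)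
      then obtain D where D: "(\<kappa> has_derivative D) (at ((1 / \<mu>) *\<^sub>R u) within Y)" using \<kappa>_deriv by blast
      have "((\<lambda>u. (1 / \<mu>) *\<^sub>R u) has_derivative (\<lambda>h. (1 / \<mu>) *\<^sub>R h)) (at u within Y)"
        by (auto intro!: derivative_eq_intros)
      moreover have "(\<kappa> has_derivative D) (at ((1 / \<mu>) *\<^sub>R u) within (\<lambda>u. (1 / \<mu>) *\<^sub>R u) ` Y)"
        using Y(1) by (intro has_derivative_subset[OF D]) (auto intro: subspace_scale)
      ultimately have "((\<lambda>u. \<kappa> ((1 / \<mu>) *\<^sub>R u)) has_derivative (\<lambda>h. D ((1 / \<mu>) *\<^sub>R h))) (at u within Y)"
        by (rule has_derivative_in_compose)
      then have "(k has_derivative (\<lambda>h. \<mu> * D ((1 / \<mu>) *\<^sub>R h))) (at u within Y)"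
        unfolding k_def by (rule has_derivative_mult_right)
      then show ?thesis by (rule exI[of _ "\<lambda>h. \<mu> * D ((1 / \<mu>) *\<^sub>R h)"])
    qed
    \<comment> \<open>The factor \<open>l + 1\<close> outweighs the variation \<open>l\<close> of
      \<open>g\<close> and leaves a surplus 1, which will bound \<open>norm w\<close>. The variable
      \<open>t\<close> is minimised out exactly, by compactness, so the variational principle acts
      on \<open>u\<close> alone.\<close>
    define H where "H = (\<lambda>u t. (l + 1) * k (u - a - t *\<^sub>R e) - t * s)"
    have H_lip: "H u t \<le> H v t + 2 * (l + 1) * norm (u - v)" for u v t
    proof -
      have "k (u - a - t *\<^sub>R e) \<le> k (v - a - t *\<^sub>R e) + 2 * norm (u - v)"
        using k_lip[of "u - a - t *\<^sub>R e" "v - a - t *\<^sub>R e"] by (simp add: abs_le_iff)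
      then have "(l + 1) * k (u - a - t *\<^sub>R e) \<le> (l + 1) * (k (v - a - t *\<^sub>R e) + 2 * norm (u - v))"
        using \<open>l \<ge> 0\<close> by (intro mult_left_mono) auto
      then show ?thesis by (simp add: H_def algebra_simps)
    qed
    have "2-lipschitz_on UNIV k" using k_lip by (intro lipschitz_onI) (auto simp: dist_norm)
    then have k_cont: "continuous_on UNIV k" by (rule lipschitz_on_continuous_on)
    have "\<exists>t\<in>{0..1}. \<forall>t'\<in>{0..1}. H u t \<le> H u t'" for u
      unfolding H_def
      by (intro continuous_attains_inf continuous_intros continuous_on_compose2[OF k_cont]) auto
    then obtain T where T: "\<And>u. T u \<in> {0..1}" "\<And>u t. t \<in> {0..1} \<Longrightarrow> H u (T u) \<le> H u t" by metis
    define \<phi> where "\<phi> = (\<lambda>u. g u - g a + H u (T u))"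
    have \<phi>_lip: "\<phi> u - \<phi> v \<le> (3 * l + 2) * norm (u - v)" for u v
    proof -
      have "g u - g v \<le> l * norm (u - v)" using lip[of u v] by simp
      then show ?thesis using T(2)[OF T(1), of u v] H_lip[of u "T v" v] by (simp add: \<phi>_def algebra_simps)
    qed
    have "(3 * l + 2)-lipschitz_on UNIV \<phi>"
    proof (rule lipschitz_onI)
      show "dist (\<phi> u) (\<phi> v) \<le> (3 * l + 2) * dist u v" for u v
        using \<phi>_lip[of u v] \<phi>_lip[of v u] by (simp add: dist_norm abs_le_iff norm_minus_commute)
    qed (use \<open>l \<ge> 0\<close> in simp)
    then have \<phi>_cont: "continuous_on Y \<phi>" by (intro continuous_on_subset[OF lipschitz_on_continuous_on]) auto
    have g_low: "g u - g a \<ge> - (l * norm (u - a - t *\<^sub>R e) + l * norm e)" if t: "t \<in> {0..1}" for u t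
    proof -
      have "norm (u - a) \<le> norm (u - a - t *\<^sub>R e) + norm (t *\<^sub>R e)"
        using norm_triangle_ineq[of "u - a - t *\<^sub>R e" "t *\<^sub>R e"] by simp
      also have "norm (t *\<^sub>R e) \<le> norm e" using t by (simp add: mult_left_le_one_le)
      finally have "l * norm (u - a) \<le> l * (norm (u - a - t *\<^sub>R e) + norm e)"
        using \<open>l \<ge> 0\<close> by (intro mult_left_mono) auto
      then show ?thesis using lip[of u a] by (simp add: distrib_left)
    qed
    have ts: "t * s \<le> \<bar>s\<bar>" if t: "t \<in> {0..1}" for t
    proof -
      have "t * s \<le> \<bar>t\<bar> * \<bar>s\<bar>" by (simp flip: abs_mult)
      also have "\<dots> \<le> \<bar>s\<bar>" using t by (intro mult_left_le_one_le) auto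
      finally show ?thesis .
    qed
    have \<phi>_low: "- (l * norm e) - \<bar>s\<bar> - \<epsilon> \<le> \<phi> u" for u
      using g_low[OF T(1), of u u] k_low[of "u - a - T u *\<^sub>R e"] ts[OF T(1), of u] by (simp add: \<phi>_def H_def)
    show ?thesis
    proof (rule smooth_variational_principle[OF Y b _ _ \<epsilon>(1) \<phi>_cont \<phi>_low])
      show "0 < max R 1" "0 \<le> (4::real)" by auto
    next
      fix x \<beta> D
      assume x: "x \<in> Y" and \<beta>: "\<And>u. 0 \<le> \<beta> u" "\<And>u. \<beta> u \<le> \<epsilon>"
        and D: "(\<beta> has_derivative D) (at x within Y)" "\<And>h. \<bar>D h\<bar> \<le> \<epsilon> * norm h"
        and min: "\<And>u. u \<in> Y \<Longrightarrow> \<phi> x - \<beta> x \<le> \<phi> u - \<beta> u"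
      define t where "t = T x"
      define w where "w = x - a - t *\<^sub>R e"
      have t: "t \<in> {0..1}" unfolding t_def by (rule T)
      have wY: "w \<in> Y" unfolding w_def using x ae Y(1) by (intro subspace_diff subspace_scale)
      have "\<phi> a \<le> H a 0" using T(2)[of 0 a] by (simp add: \<phi>_def)
      then have "\<phi> a \<le> 0" by (simp add: H_def k0)
      then have \<phi>x: "\<phi> x \<le> \<epsilon>" using min[OF ae(1)] \<beta>(1)[of a] \<beta>(2)[of x] by linarith
      have \<phi>_eq: "\<phi> x = g x - g a + (l + 1) * k w - t * s" by (simp add: \<phi>_def H_def t_def w_def)
      have "t < 1"
      proof (rule ccontr)
        assume "\<not> t < 1"
        then have "t = 1" using t by simp
        then have "norm (x - (a + e)) = norm w" by (simp add: w_def algebra_simps)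
        then have "g (a + e) - g x \<le> l * norm w" using lip[of x "a + e"] by (simp add: abs_le_iff)
        then have "\<gamma> - \<epsilon> \<le> \<phi> x" using k_low[of w] \<open>t = 1\<close> by (simp add: \<phi>_eq \<gamma>_def)
        then show False using \<phi>x \<epsilon>(3) \<open>\<gamma> > 0\<close> by linarith
      qed
      obtain Dk where Dk: "(k has_derivative Dk) (at w within Y)" using k_deriv[OF wY] by blast
      have lin_k: "linear Dk" using has_derivative_bounded_linear[OF Dk] by (rule bounded_linear.linear)
      \<comment> \<open>Increasing \<open>t\<close> to \<open>t + r\<close> shifts the argument of
        \<open>k\<close> by \<open>- r\<close> times \<open>e\<close> and cannot lower
        \<open>H x\<close>. For small \<open>r\<close> this bounds the derivative along
        \<open>e\<close>.\<close>
      have "- Dk (- e) \<le> - s / (l + 1)"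
      proof (rule has_derivative_le_slope[where f = "\<lambda>u. - k u" and x = w and S = Y and \<tau> = "1 - t" and h = "- e"])
        show "((\<lambda>u. - k u) has_derivative (\<lambda>h. - Dk h)) (at w within Y)" using Dk by (rule has_derivative_minus)
        show "1 - t > 0" using \<open>t < 1\<close> by simp
        fix r :: real assume r: "0 < r" "r < 1 - t"
        have "H x t \<le> H x (t + r)" unfolding t_def by (rule T(2)) (use r t in \<open>auto simp: t_def\<close>)
        moreover have "x - a - (t + r) *\<^sub>R e = w + r *\<^sub>R - e" by (simp add: w_def algebra_simps)
        ultimately have "(l + 1) * (- k (w + r *\<^sub>R - e) - - k w) \<le> - (r * s)"
          by (simp add: H_def algebra_simps flip: w_def)
        then have "- k (w + r *\<^sub>R - e) - - k w \<le> - (r * s) / (l + 1)"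
          using \<open>l \<ge> 0\<close> by (subst pos_le_divide_eq) (simp_all add: mult.commute)
        then have "- k (w + r *\<^sub>R - e) - - k w \<le> r * (- s / (l + 1))" by simp
        moreover have "w + r *\<^sub>R - e \<in> Y" using wY ae Y(1) by (intro subspace_add subspace_scale subspace_neg)
        ultimately show "w + r *\<^sub>R - e \<in> Y \<and> - k (w + r *\<^sub>R - e) - - k w \<le> r * (- s / (l + 1))" by blast
      qed
      then have "Dk e * (l + 1) \<le> - s"
        using \<open>l \<ge> 0\<close> linear_neg[OF lin_k, of e] by (subst pos_le_divide_eq[symmetric]) simp_all
      then have Dk_e: "s \<le> - ((l + 1) * Dk e)" by (simp add: mult.commute)
      \<comment> \<open>With \<open>t\<close> frozen at its optimal value for \<open>x\<close>,
        \<open>\<phi> u\<close> is at most \<open>g u - g a + H u t\<close>, with equality at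
        \<open>x\<close>. So the increments of \<open>q\<close> from \<open>x\<close> are below
        those of \<open>g\<close>, and the derivative of \<open>q\<close> along \<open>Y\<close> is
        a subgradient.\<close>
      define q where "q = (\<lambda>u. \<beta> u - (l + 1) * k (u - (a + t *\<^sub>R e)))"
      define Dy where "Dy = (\<lambda>h. D h - (l + 1) * Dk h)"
      have q: "(q has_derivative Dy) (at x within Y)"
      proof -
        have w_eq: "w = x - (a + t *\<^sub>R e)" by (simp add: w_def)
        have "((\<lambda>u. u - (a + t *\<^sub>R e)) has_derivative (\<lambda>h. h)) (at x within Y)"
          by (auto intro!: derivative_eq_intros)
        moreover have "(k has_derivative Dk) (at (x - (a + t *\<^sub>R e)) within (\<lambda>u. u - (a + t *\<^sub>R e)) ` Y)"
          unfolding w_eq[symmetric] using ae Y(1)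
          by (intro has_derivative_subset[OF Dk]) (auto intro!: subspace_diff subspace_add subspace_scale)
        ultimately have "((\<lambda>u. k (u - (a + t *\<^sub>R e))) has_derivative (\<lambda>h. Dk h)) (at x within Y)"
          by (rule has_derivative_in_compose)
        then show ?thesis unfolding q_def Dy_def by (intro has_derivative_diff D has_derivative_mult_right)
      qed
      have q_min: "q u - q x \<le> g u - g x" if u: "u \<in> Y" for u
      proof -
        have "\<phi> u \<le> g u - g a + H u t" using T(2)[OF t, of u] by (simp add: \<phi>_def)
        then show ?thesis using min[OF u] by (simp add: q_def \<phi>_eq H_def w_def algebra_simps)
      qed
      have "frechet_subgradient_within Y g x Dy"
        unfolding frechet_subgradient_within_def
      proof (intro conjI allI impI)
        show "bounded_linear Dy" using q by (rule has_derivative_bounded_linear)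
        fix \<epsilon>' :: real assume "\<epsilon>' > 0"
        then obtain d where d: "d > 0" "\<And>y. y \<in> Y \<Longrightarrow> norm (y - x) < d \<Longrightarrow> norm (q y - q x - Dy (y - x)) \<le> \<epsilon>' * norm (y - x)"
          using q unfolding has_derivative_within_alt by blast
        have "Dy h \<le> g (x + h) - g x + \<epsilon>' * norm h" if "x + h \<in> Y" "norm h \<le> d / 2" for h
          using d(2)[of "x + h"] q_min[of "x + h"] that d(1) by (simp add: abs_le_iff)
        then show "\<exists>d>0. \<forall>h. x + h \<in> Y \<longrightarrow> norm h \<le> d \<longrightarrow> Dy h \<le> g (x + h) - g x + \<epsilon>' * norm h"
          using d(1) by (intro exI[of _ "d / 2"]) auto
      qed
      moreover have "s - \<eta> * norm e \<le> Dy e"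
      proof -
        have "\<epsilon> * norm e \<le> \<eta> * norm e" using \<epsilon>(2) by (intro mult_right_mono) auto
        then show ?thesis using D(2)[of e] Dk_e unfolding Dy_def by linarith
      qed
      ultimately obtain D' where D': "frechet_subgradient_within UNIV g x D'" "s - \<eta> * norm e \<le> D' e"
        using reduce[of x Dy] x unfolding Y_def by blast
      \<comment> \<open>Beyond radius \<open>\<mu> * R\<close> the penalty is at least
        \<open>(l + 1) * norm w\<close>; \<open>g\<close> can offset \<open>l * norm w\<close> of
        it, and the surplus \<open>norm w\<close> remains.\<close>
      have "norm w \<le> l * norm e + \<bar>s\<bar> + \<eta>"
      proof (cases "norm w \<ge> \<mu> * R")
        case True
        then have "(l + 1) * norm w \<le> (l + 1) * k w" using k_far \<open>l \<ge> 0\<close> by (intro mult_left_mono) auto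
        then show ?thesis
          using \<phi>x g_low[OF t, of x] ts[OF t] \<epsilon>(2) unfolding \<phi>_eq w_def[symmetric] by (simp add: distrib_right)
      next
        case False
        then show ?thesis using \<mu>R(1) \<epsilon>(2) \<open>l \<ge> 0\<close> by (smt (verit) mult_nonneg_nonneg norm_ge_zero)
      qed
      moreover have "norm (x - a) \<le> norm w + norm e"
      proof -
        have "norm (x - a) \<le> norm w + norm (t *\<^sub>R e)" using norm_triangle_ineq[of w "t *\<^sub>R e"] by (simp add: w_def)
        also have "norm (t *\<^sub>R e) \<le> norm e" using t by (simp add: mult_left_le_one_le)
        finally show ?thesis by simp
      qed
      ultimately have "norm (x - a) \<le> (l + 1) * norm e + \<bar>s\<bar> + \<eta>" by (simp add: distrib_right)
      with D' show ?thesis by (rule that)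
    qed
  qed
qed

subsection \<open>Extended-real-valued functions\<close>

text \<open>McShane's formula: the infimum of the cones \<open>f v + l * norm (u - v)\<close>. The
  separable reduction and the mean value inequality both ask for a globally Lipschitz
  function.\<close>

lemma lipschitz_extension:
  fixes f :: "'a::real_normed_vector \<Rightarrow> real"
  assumes "A \<noteq> {}" "l \<ge> 0" and lip: "\<And>u v. u \<in> A \<Longrightarrow> v \<in> A \<Longrightarrow> \<bar>f u - f v\<bar> \<le> l * norm (u - v)"
  obtains g where "\<And>u. u \<in> A \<Longrightarrow> g u = f u" "\<And>u v. \<bar>g u - g v\<bar> \<le> l * norm (u - v)"
proof
  define g where "g = (\<lambda>u. INF v\<in>A. f v + l * norm (u - v))"
  have tri: "l * norm (u - w) \<le> l * norm (u - v) + l * norm (v - w)" for u v w :: 'a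
    using mult_left_mono[OF norm_triangle_ineq[of "u - v" "v - w"] \<open>l \<ge> 0\<close>] by (simp add: distrib_left)
  have low: "f v - l * norm (u - v) \<le> f w + l * norm (u - w)" if "v \<in> A" "w \<in> A" for u v w
    using lip[OF that] tri[of v w u] by (simp add: norm_minus_commute abs_le_iff)
  obtain v0 where "v0 \<in> A" using assms(1) by blast
  then have bdd: "bdd_below ((\<lambda>v. f v + l * norm (u - v)) ` A)" for u using low[of v0] by (intro bdd_belowI2) auto
  have upper: "g u \<le> f v + l * norm (u - v)" if "v \<in> A" for u v unfolding g_def using bdd that by (rule cINF_lower)
  have lower: "c \<le> g u" if "\<And>v. v \<in> A \<Longrightarrow> c \<le> f v + l * norm (u - v)" for c u
    unfolding g_def using assms(1) that by (rule cINF_greatest)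
  show "g u = f u" if "u \<in> A" for u
    using upper[OF that, of u] low[OF that, of _ u] by (intro antisym lower) auto
  have le: "g u - l * norm (u - v) \<le> g v" for u v
  proof (rule lower)
    fix w assume "w \<in> A"
    then show "g u - l * norm (u - v) \<le> f w + l * norm (v - w)" using upper[of w u] tri[of u w v] by linarith
  qed
  show "\<bar>g u - g v\<bar> \<le> l * norm (u - v)" for u v
    using le[of u v] le[of v u] by (simp add: norm_minus_commute abs_le_iff)
qed

text \<open>Locality of the Frechet subdifferential: \<open>g\<close> may be any real function
  agreeing with \<open>f\<close> near \<open>x\<close>, in particular a Lipschitz extension. The
  inequality is trivial at \<open>h = 0\<close>, so the punctured lower limit loses nothing.\<close>

lemma frechet_subdiff_iff:
  fixes f :: "'a::real_normed_vector \<Rightarrow> ereal"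
  assumes U: "open U" "x \<in> U" and f: "\<And>u. u \<in> U \<Longrightarrow> f u = ereal (g u)"
  shows "v \<in> frechet_subdiff f x \<longleftrightarrow> frechet_subgradient_within UNIV g x (blinfun_apply v)"
proof -
  define Q where "Q = (\<lambda>u. (f u - f x - ereal (blinfun_apply v (u - x))) / ereal (norm (u - x)))"
  have nhd: "\<forall>\<^sub>F u in at x. u \<in> U \<and> u \<noteq> x"
    using U by (intro eventually_conj eventually_at_in_open' eventually_at_filter[THEN iffD2]) auto
  have Q: "Q u = ereal ((g u - g x - blinfun_apply v (u - x)) / norm (u - x))" if "u \<in> U" "u \<noteq> x" for u
    using f[OF that(1)] f[OF U(2)] that(2) by (simp add: Q_def)
  have bound_iff: "ereal (- e) \<le> Q u \<longleftrightarrow> blinfun_apply v (u - x) \<le> g u - g x + e * norm (u - x)"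
    if "u \<in> U" "u \<noteq> x" for u e
    unfolding Q[OF that] using that(2) by (simp add: le_divide_eq algebra_simps)
  have "x \<in> eff_dom f" using f[OF U(2)] by (simp add: eff_dom_def)
  then have "v \<in> frechet_subdiff f x \<longleftrightarrow> 0 \<le> Liminf (at x) Q" by (simp add: frechet_subdiff_def Q_def)
  also have "\<dots> \<longleftrightarrow> (\<forall>e>0. \<forall>\<^sub>F u in at x. ereal (- e) \<le> Q u)"
  proof
    assume lim: "0 \<le> Liminf (at x) Q"
    show "\<forall>e>0. \<forall>\<^sub>F u in at x. ereal (- e) \<le> Q u"
    proof (intro allI impI)
      fix e :: real assume "e > 0"
      then have "\<forall>\<^sub>F u in at x. ereal (- e) < Q u" using lim unfolding le_Liminf_iff by simp
      then show "\<forall>\<^sub>F u in at x. ereal (- e) \<le> Q u" by eventually_elim simp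
    qed
  next
    assume *: "\<forall>e>0. \<forall>\<^sub>F u in at x. ereal (- e) \<le> Q u"
    show "0 \<le> Liminf (at x) Q"
      unfolding le_Liminf_iff
    proof (intro allI impI)
      fix y :: ereal assume "y < 0"
      then obtain r where r: "y < ereal r" "ereal r < 0" using ereal_dense2 by blast
      then have "\<forall>\<^sub>F u in at x. ereal (- (- r)) \<le> Q u" using * by (simp del: minus_minus)
      then show "\<forall>\<^sub>F u in at x. y < Q u" using r(1) by (auto elim!: eventually_mono)
    qed
  qed
  also have "\<dots> \<longleftrightarrow> (\<forall>e>0. \<exists>d>0. \<forall>h. norm h \<le> d \<longrightarrow> blinfun_apply v h \<le> g (x + h) - g x + e * norm h)"
  proof (intro all_cong1 imp_cong refl)
    fix e :: real assume "e > 0"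
    have "(\<forall>\<^sub>F u in at x. ereal (- e) \<le> Q u) \<longleftrightarrow>
        (\<forall>\<^sub>F u in at x. blinfun_apply v (u - x) \<le> g u - g x + e * norm (u - x))"
      by (rule eventually_cong[OF nhd]) (auto simp: bound_iff)
    also have "\<dots> \<longleftrightarrow> (\<exists>d>0. \<forall>u. u \<noteq> x \<and> dist u x \<le> d \<longrightarrow> blinfun_apply v (u - x) \<le> g u - g x + e * norm (u - x))"
      by (simp add: eventually_at_le)
    also have "\<dots> \<longleftrightarrow> (\<exists>d>0. \<forall>h. norm h \<le> d \<longrightarrow> blinfun_apply v h \<le> g (x + h) - g x + e * norm h)"
    proof (intro ex_cong1 conj_cong refl)
      fix d :: real
      show "(\<forall>u. u \<noteq> x \<and> dist u x \<le> d \<longrightarrow> blinfun_apply v (u - x) \<le> g u - g x + e * norm (u - x)) \<longleftrightarrow>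
          (\<forall>h. norm h \<le> d \<longrightarrow> blinfun_apply v h \<le> g (x + h) - g x + e * norm h)"
      proof (intro iffI allI impI)
        fix h :: 'a assume *: "\<forall>u. u \<noteq> x \<and> dist u x \<le> d \<longrightarrow> blinfun_apply v (u - x) \<le> g u - g x + e * norm (u - x)" "norm h \<le> d"
        show "blinfun_apply v h \<le> g (x + h) - g x + e * norm h"
          using *(1)[rule_format, of "x + h"] *(2) by (cases "h = 0") (auto simp: dist_norm blinfun.zero_right)
      next
        fix u assume *: "\<forall>h. norm h \<le> d \<longrightarrow> blinfun_apply v h \<le> g (x + h) - g x + e * norm h" "u \<noteq> x \<and> dist u x \<le> d"
        then show "blinfun_apply v (u - x) \<le> g u - g x + e * norm (u - x)"
          using *(1)[rule_format, of "u - x"] by (simp add: dist_norm)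
      qed
    qed
    finally show "(\<forall>\<^sub>F u in at x. ereal (- e) \<le> Q u) \<longleftrightarrow>
        (\<exists>d>0. \<forall>h. norm h \<le> d \<longrightarrow> blinfun_apply v h \<le> g (x + h) - g x + e * norm h)" .
  qed
  also have "\<dots> \<longleftrightarrow> frechet_subgradient_within UNIV g x (blinfun_apply v)"
    by (simp add: frechet_subgradient_within_def blinfun.bounded_linear_right)
  finally show ?thesis .
qed

text \<open>The product metric lies between each coordinate distance and their sum, so
  neighbourhoods of \<open>(a, a)\<close> can be traded for pairs of balls. On the diagonal the
  estimate reads \<open>0 \<le> 0\<close>.\<close>

lemma strictly_differentiable_at_iff:
  fixes f :: "'a::real_normed_vector \<Rightarrow> ereal"
  assumes U: "open U" "a \<in> U" and f: "\<And>u. u \<in> U \<Longrightarrow> f u = ereal (g u)"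
  shows "strictly_differentiable_at f a \<longleftrightarrow>
    (\<exists>v. \<forall>e>0. \<exists>d>0. \<forall>x\<in>ball a d. \<forall>y\<in>ball a d. \<bar>g x - g y - blinfun_apply v (x - y)\<bar> \<le> e * norm (x - y))"
  unfolding strictly_differentiable_at_def
proof (rule ex_cong1)
  fix v :: "'a \<Rightarrow>\<^sub>L real"
  let ?F = "at (a, a) within {(x, y). x \<noteq> y}"
  define Q where "Q = (\<lambda>(x, y). (f x - f y - ereal (blinfun_apply v (x - y))) / ereal (norm (x - y)))"
  define q where "q = (\<lambda>(x, y). (g x - g y - blinfun_apply v (x - y)) / norm (x - y))"
  have "\<forall>\<^sub>F p in ?F. p \<in> U \<times> U"
    using U by (intro topological_tendstoD[OF tendsto_ident_at] open_Times) auto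
  moreover have "\<forall>\<^sub>F p in ?F. p \<in> {(x, y). x \<noteq> y}" by (simp add: eventually_at_filter)
  ultimately have nhd: "\<forall>\<^sub>F p in ?F. Q p = ereal (q p)"
    by eventually_elim (auto simp: Q_def q_def f)
  have "(Q \<longlongrightarrow> 0) ?F \<longleftrightarrow> ((\<lambda>p. ereal (q p)) \<longlongrightarrow> ereal 0) ?F"
    unfolding zero_ereal_def using nhd by (rule tendsto_cong)
  also have "\<dots> \<longleftrightarrow> (q \<longlongrightarrow> 0) ?F" by (rule lim_ereal)
  also have "\<dots> \<longleftrightarrow> (\<forall>e>0. \<exists>d>0. \<forall>x\<in>ball a d. \<forall>y\<in>ball a d. \<bar>g x - g y - blinfun_apply v (x - y)\<bar> \<le> e * norm (x - y))"
  proof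
    assume lim: "(q \<longlongrightarrow> 0) ?F"
    show "\<forall>e>0. \<exists>d>0. \<forall>x\<in>ball a d. \<forall>y\<in>ball a d. \<bar>g x - g y - blinfun_apply v (x - y)\<bar> \<le> e * norm (x - y)"
    proof (intro allI impI)
      fix e :: real assume "e > 0"
      then have "\<forall>\<^sub>F p in ?F. \<bar>q p\<bar> < e" using tendstoD[OF lim, of e] by (simp add: dist_real_def)
      then obtain d where d: "d > 0" "\<And>x y. x \<noteq> y \<Longrightarrow> dist (x, y) (a, a) < d \<Longrightarrow> \<bar>q (x, y)\<bar> < e"
        unfolding eventually_at by fastforce
      have "\<bar>g x - g y - blinfun_apply v (x - y)\<bar> \<le> e * norm (x - y)"
        if "x \<in> ball a (d / 2)" "y \<in> ball a (d / 2)" for x y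
      proof (cases "x = y")
        case False
        have "dist (x, y) (a, a) \<le> dist x a + dist y a"
          unfolding dist_Pair_Pair by (rule sqrt_sum_squares_le_sum) auto
        also have "\<dots> < d" using that by (simp add: dist_commute)
        finally have "\<bar>q (x, y)\<bar> < e" using False d(2) by blast
        then show ?thesis using False by (simp add: q_def divide_less_eq)
      qed (simp add: blinfun.zero_right)
      then show "\<exists>d>0. \<forall>x\<in>ball a d. \<forall>y\<in>ball a d. \<bar>g x - g y - blinfun_apply v (x - y)\<bar> \<le> e * norm (x - y)"
        using d(1) by (intro exI[of _ "d / 2"]) auto
    qed
  next
    assume *: "\<forall>e>0. \<exists>d>0. \<forall>x\<in>ball a d. \<forall>y\<in>ball a d. \<bar>g x - g y - blinfun_apply v (x - y)\<bar> \<le> e * norm (x - y)"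
    show "(q \<longlongrightarrow> 0) ?F"
    proof (rule tendstoI)
      fix e :: real assume "e > 0"
      then obtain d where d: "d > 0"
        "\<And>x y. x \<in> ball a d \<Longrightarrow> y \<in> ball a d \<Longrightarrow> \<bar>g x - g y - blinfun_apply v (x - y)\<bar> \<le> e / 2 * norm (x - y)"
        using *[rule_format, of "e / 2"] by auto
      have "\<bar>q (x, y)\<bar> < e" if "x \<noteq> y" "dist (x, y) (a, a) < d" for x y
      proof -
        have "x \<in> ball a d" "y \<in> ball a d"
          using that(2) dist_fst_le[of "(x, y)" "(a, a)"] dist_snd_le[of "(x, y)" "(a, a)"] by (auto simp: dist_commute)
        then have "\<bar>g x - g y - blinfun_apply v (x - y)\<bar> \<le> e / 2 * norm (x - y)" by (rule d(2))
        also have "\<dots> < e * norm (x - y)" using \<open>e > 0\<close> that(1) by simp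
        finally show ?thesis using that(1) by (simp add: q_def divide_less_eq)
      qed
      then show "\<forall>\<^sub>F p in ?F. dist (q p) 0 < e"
        unfolding eventually_at using d(1) by (intro exI[of _ d]) (auto simp: dist_real_def)
    qed
  qed
  finally show "(Q \<longlongrightarrow> 0) ?F \<longleftrightarrow>
      (\<forall>e>0. \<exists>d>0. \<forall>x\<in>ball a d. \<forall>y\<in>ball a d. \<bar>g x - g y - blinfun_apply v (x - y)\<bar> \<le> e * norm (x - y))" .
qed

text \<open>If no \<open>d\<close> works for some \<open>e\<close>, violations picked in the balls
  of radius \<open>1 / (k + 1)\<close> form a sequence contradicting the sequential
  definition.\<close>

lemma strongly_continuous_atD:
  assumes "strongly_continuous_at S a"
  obtains v where "\<And>e. e > 0 \<Longrightarrow> \<exists>d>0. \<forall>x\<in>ball a d. \<forall>w\<in>S x. norm (w - v) < e"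
proof -
  obtain v where v: "\<And>x w. x \<longlonglongrightarrow> a \<Longrightarrow> (\<And>k. w k \<in> S (x k)) \<Longrightarrow> (\<lambda>k::nat. norm (w k - v)) \<longlonglongrightarrow> 0"
    using assms unfolding strongly_continuous_at_def by blast
  have "\<exists>d>0. \<forall>x\<in>ball a d. \<forall>w\<in>S x. norm (w - v) < e" if "e > 0" for e
  proof (rule ccontr)
    assume neg: "\<not> ?thesis"
    have "\<exists>x w. x \<in> ball a (inverse (Suc k)) \<and> w \<in> S x \<and> norm (w - v) \<ge> e" for k
      using neg by (auto simp: not_less dest!: spec[of _ "inverse (real (Suc k))"])
    then obtain x w where xw: "\<And>k. x k \<in> ball a (inverse (Suc k))" "\<And>k. w k \<in> S (x k)" "\<And>k. norm (w k - v) \<ge> e"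
      by metis
    have "x \<longlonglongrightarrow> a"
    proof (rule metric_LIMSEQ_I)
      fix r :: real assume "r > 0"
      then obtain N where N: "inverse (Suc N) < r" using reals_Archimedean by blast
      have "dist (x n) a < r" if "n \<ge> N" for n
      proof -
        have "inverse (real (Suc n)) \<le> inverse (real (Suc N))" using that by (intro le_imp_inverse_le) auto
        moreover have "dist (x n) a < inverse (real (Suc n))" using xw(1)[of n] by (simp add: dist_commute)
        ultimately show ?thesis using N by linarith
      qed
      then show "\<exists>N. \<forall>n\<ge>N. dist (x n) a < r" by blast
    qed
    then have "(\<lambda>k. norm (w k - v)) \<longlonglongrightarrow> 0" using xw(2) by (rule v)
    then have "e \<le> 0" using xw(3) by (intro LIMSEQ_le_const) auto
    then show False using that by simp
  qed
  then show ?thesis by (rule that)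
qed

text \<open>A violating pair yields, by the mean value inequality with \<open>e = x - y\<close>, a
  subgradient \<open>D\<close> near \<open>a\<close> with
  \<open>D e - v e \<ge> 2 * \<tau> * norm e\<close>, although \<open>D\<close> is within \<tau> of
  \<open>v\<close>. Of the 3 in the bound, one part pays for \<eta>, one for
  \<open>norm (D - v)\<close>, and one is left for the contradiction.\<close>

lemma asplund_strict_estimate:
  fixes g :: "'a::banach \<Rightarrow> real"
  assumes asp: "asplund_space TYPE('a)" and lip: "\<And>u v. \<bar>g u - g v\<bar> \<le> l * norm (u - v)" and "l \<ge> 0"
    and "\<tau> > 0" "\<delta> > 0"
    and near: "\<And>x w. x \<in> ball a \<delta> \<Longrightarrow> frechet_subgradient_within UNIV g x (blinfun_apply w) \<Longrightarrow> norm (w - v) < \<tau>"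
  obtains \<rho> where "\<rho> > 0"
    "\<And>x y. x \<in> ball a \<rho> \<Longrightarrow> y \<in> ball a \<rho> \<Longrightarrow> \<bar>g x - g y - blinfun_apply v (x - y)\<bar> \<le> 3 * \<tau> * norm (x - y)"
proof
  define \<eta> where "\<eta> = min \<tau> (\<delta> / 2)"
  have \<eta>: "\<eta> > 0" "\<eta> \<le> \<tau>" "\<eta> \<le> \<delta> / 2" using \<open>\<tau> > 0\<close> \<open>\<delta> > 0\<close> by (auto simp: \<eta>_def)
  define K where "K = l + 1 + norm v + 3 * \<tau>"
  have "K \<ge> 0" using \<open>l \<ge> 0\<close> \<open>\<tau> > 0\<close> by (simp add: K_def)
  \<comment> \<open>\<open>K\<close> bounds the coefficient of \<open>norm e\<close> in
    \<open>(l + 1) * norm e + \<bar>s\<bar>\<close>. As \<open>norm e \<le> 2 * \<rho>\<close> and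
    \<open>y\<close> is within \<rho> of \<open>a\<close>, the point found is closer to
    \<open>a\<close> than \<open>\<rho> * (1 + 2 * K) + \<eta> \<le> \<delta>\<close>.\<close>
  define \<rho> where "\<rho> = \<delta> / 2 / (1 + 2 * K)"
  have \<rho>: "\<rho> * (1 + 2 * K) = \<delta> / 2" using \<open>K \<ge> 0\<close> unfolding \<rho>_def by (subst nonzero_eq_divide_eq[symmetric]) auto
  show "\<rho> > 0" using \<open>K \<ge> 0\<close> \<open>\<delta> > 0\<close> by (simp add: \<rho>_def)
  have le: "g x - g y \<le> blinfun_apply v (x - y) + 3 * \<tau> * norm (x - y)"
    if xy: "x \<in> ball a \<rho>" "y \<in> ball a \<rho>" for x y
  proof (rule ccontr)
    assume neg: "\<not> ?thesis"
    define e where "e = x - y"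
    define s where "s = blinfun_apply v e + 3 * \<tau> * norm e"
    have "g (y + e) - g y > s" using neg by (simp add: e_def s_def)
    then obtain z D where D: "frechet_subgradient_within UNIV g z D" "D e \<ge> s - \<eta> * norm e"
      "norm (z - y) \<le> (l + 1) * norm e + \<bar>s\<bar> + \<eta>"
      using asplund_mean_value[OF asp lip \<open>l \<ge> 0\<close> _ \<eta>(1)] by blast
    have "e \<noteq> 0" using neg by (auto simp: e_def blinfun.zero_right)
    have ya: "norm (y - a) < \<rho>" and xa: "norm (x - a) < \<rho>" using xy by (simp_all add: dist_norm norm_minus_commute)
    have "norm e \<le> norm (x - a) + norm (y - a)" unfolding e_def using norm_triangle_ineq4[of "x - a" "y - a"] by simp
    then have e: "norm e \<le> 2 * \<rho>" using ya xa by simp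
    have "\<bar>blinfun_apply v e\<bar> \<le> norm v * norm e" using norm_blinfun[of v e] by simp
    moreover have "0 \<le> 3 * \<tau> * norm e" using \<open>\<tau> > 0\<close> by simp
    ultimately have "\<bar>s\<bar> \<le> (norm v + 3 * \<tau>) * norm e" unfolding s_def distrib_right by linarith
    then have "norm (z - y) \<le> K * norm e + \<eta>" using D(3) by (simp add: K_def algebra_simps)
    also have "K * norm e \<le> K * (2 * \<rho>)" using e \<open>K \<ge> 0\<close> by (rule mult_left_mono)
    finally have "norm (z - y) + \<rho> \<le> \<rho> * (1 + 2 * K) + \<eta>" by (simp add: algebra_simps)
    then have "norm (z - y) + norm (y - a) < \<delta>" using \<rho> ya \<eta>(3) by simp
    then have "z \<in> ball a \<delta>"
      using norm_triangle_ineq[of "z - y" "y - a"] by (simp add: dist_norm norm_minus_commute)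
    moreover have blin: "bounded_linear D" using D(1) by (simp add: frechet_subgradient_within_def)
    ultimately have "norm (Blinfun D - v) < \<tau>"
      using D(1) by (intro near) (auto simp: bounded_linear_Blinfun_apply)
    then have "norm (Blinfun D - v) * norm e \<le> \<tau> * norm e" by (intro mult_right_mono) auto
    moreover have "D e - blinfun_apply v e \<le> norm (Blinfun D - v) * norm e"
      using norm_blinfun[of "Blinfun D - v" e] blin by (simp add: blinfun.diff_left bounded_linear_Blinfun_apply)
    moreover have "\<eta> * norm e \<le> \<tau> * norm e" using \<eta>(2) by (intro mult_right_mono) auto
    ultimately have "3 * \<tau> * norm e \<le> 2 * (\<tau> * norm e)" using D(2) unfolding s_def by linarith
    then show False using \<open>\<tau> > 0\<close> \<open>e \<noteq> 0\<close> by simp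
  qed
  show "\<bar>g x - g y - blinfun_apply v (x - y)\<bar> \<le> 3 * \<tau> * norm (x - y)"
    if xy: "x \<in> ball a \<rho>" "y \<in> ball a \<rho>" for x y
  proof -
    have "blinfun_apply v (y - x) = - blinfun_apply v (x - y)" by (simp add: blinfun.diff_right)
    then show ?thesis using le[OF xy] le[OF xy(2,1)] by (simp add: abs_le_iff norm_minus_commute)
  qed
qed

text \<open>For small \<open>h\<close> the subgradient inequality and the estimate each contribute
  \<open>e * norm h\<close>; homogeneity carries the bound to all \<open>h\<close>.\<close>

lemma subgradient_close_if_strict_estimate:
  fixes g :: "'a::real_normed_vector \<Rightarrow> real"
  assumes "e > 0" "x \<in> ball a d" and w: "frechet_subgradient_within UNIV g x (blinfun_apply w)"
    and est: "\<And>y. y \<in> ball a d \<Longrightarrow> \<bar>g y - g x - blinfun_apply v (y - x)\<bar> \<le> e * norm (y - x)"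
  shows "norm (w - v) \<le> 2 * e"
proof -
  obtain r where r: "r > 0" "\<And>h. norm h \<le> r \<Longrightarrow> blinfun_apply w h \<le> g (x + h) - g x + e * norm h"
    using w \<open>e > 0\<close> unfolding frechet_subgradient_within_def by auto
  define q where "q = min r ((d - dist a x) / 2)"
  have "q > 0" using r(1) assms(2) by (simp add: q_def)
  have small: "blinfun_apply (w - v) h \<le> 2 * e * norm h" if h: "norm h \<le> q" for h
  proof -
    have "dist a (x + h) \<le> dist a x + norm h" by (metis dist_add_cancel dist_norm dist_triangle add.commute
        add_diff_cancel_left' norm_minus_commute)
    then have "x + h \<in> ball a d" using h assms(2) by (auto simp: q_def)
    from est[OF this] have "g (x + h) - g x - blinfun_apply v h \<le> e * norm h" by (simp add: abs_le_iff)
    moreover have "blinfun_apply w h \<le> g (x + h) - g x + e * norm h" using h by (intro r(2)) (simp add: q_def)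
    ultimately show ?thesis by (simp add: blinfun.diff_left)
  qed
  have le: "blinfun_apply (w - v) h \<le> 2 * e * norm h" for h
  proof (cases "h = 0")
    case False
    define t where "t = q / norm h"
    have "t > 0" using \<open>q > 0\<close> False by (simp add: t_def)
    have "blinfun_apply (w - v) (t *\<^sub>R h) \<le> 2 * e * norm (t *\<^sub>R h)"
      using \<open>q > 0\<close> False by (intro small) (simp add: t_def)
    then have "t * blinfun_apply (w - v) h \<le> t * (2 * e * norm h)"
      using \<open>t > 0\<close> by (simp add: blinfun.scaleR_right mult_ac)
    then show ?thesis using \<open>t > 0\<close> by (rule mult_left_le_imp_le)
  qed (simp add: blinfun.zero_right)
  have "norm (blinfun_apply (w - v) h) \<le> 2 * e * norm h" for h
    using le[of h] le[of "- h"] by (simp add: blinfun.minus_right abs_le_iff)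
  then show ?thesis using \<open>e > 0\<close> by (intro norm_blinfun_bound) auto
qed

theorem theorem6p1:
  fixes f :: "'a::banach \<Rightarrow> ereal" and xbar :: 'a
  assumes "asplund_space TYPE('a)"
    and "\<forall>x. f x \<noteq> -\<infinity>"
    and "xbar \<in> interior (eff_dom f)"
  shows "locally_lipschitz_around f xbar \<and> strongly_continuous_at (frechet_subdiff f) xbar
           \<longleftrightarrow> strictly_differentiable_at f xbar"
proof -
  define f0 where "f0 = real_of_ereal \<circ> f"
  obtain r where r: "r > 0" "ball xbar r \<subseteq> eff_dom f" using assms(3) by (auto simp: mem_interior)
  have f0: "f u = ereal (f0 u)" if "u \<in> ball xbar r" for u
  proof -
    have "f u < \<infinity>" using that r(2) by (auto simp: eff_dom_def)
    then show ?thesis using assms(2) by (cases "f u") (auto simp: f0_def)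
  qed
  show ?thesis
  proof
    assume L: "locally_lipschitz_around f xbar \<and> strongly_continuous_at (frechet_subdiff f) xbar"
    then obtain l \<delta> where l: "l \<ge> 0" "\<delta> > 0"
      "\<And>x w. x \<in> cball xbar \<delta> \<Longrightarrow> w \<in> cball xbar \<delta> \<Longrightarrow> \<bar>f x - f w\<bar> \<le> ereal (l * norm (x - w))"
      unfolding locally_lipschitz_around_def by blast
    define B where "B = ball xbar (min r \<delta>)"
    have B: "open B" "xbar \<in> B" using r(1) l(2) by (auto simp: B_def)
    have "\<bar>f0 x - f0 w\<bar> \<le> l * norm (x - w)" if "x \<in> B" "w \<in> B" for x w
      using l(3)[of x w] f0[of x] f0[of w] that by (simp add: B_def)
    \<comment> \<open>\<open>g\<close> is Lipschitz everywhere and equals \<open>f\<close> on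
      \<open>B\<close>, so there its subgradients are those of \<open>f\<close>.\<close>
    then obtain g where gf: "\<And>u. u \<in> B \<Longrightarrow> g u = f0 u" and lip: "\<And>u v. \<bar>g u - g v\<bar> \<le> l * norm (u - v)"
      using lipschitz_extension[of B l f0] B(2) l(1) by blast
    have fg: "f u = ereal (g u)" if "u \<in> B" for u using that gf[OF that] f0[of u] by (simp add: B_def)
    obtain v where v: "\<And>e. e > 0 \<Longrightarrow> \<exists>d>0. \<forall>x\<in>ball xbar d. \<forall>w\<in>frechet_subdiff f x. norm (w - v) < e"
      using L strongly_continuous_atD[of "frechet_subdiff f" xbar] by blast
    have "\<exists>d>0. \<forall>x\<in>ball xbar d. \<forall>y\<in>ball xbar d. \<bar>g x - g y - blinfun_apply v (x - y)\<bar> \<le> e * norm (x - y)"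
      if "e > 0" for e
    proof -
      obtain d where d: "d > 0" "\<And>x w. x \<in> ball xbar d \<Longrightarrow> w \<in> frechet_subdiff f x \<Longrightarrow> norm (w - v) < e / 3"
        using v[of "e / 3"] \<open>e > 0\<close> by auto
      define d' where "d' = min d (min r \<delta>)"
      have d': "d' > 0" using d(1) r(1) l(2) by (simp add: d'_def)
      have near: "norm (w - v) < e / 3"
        if "x \<in> ball xbar d'" "frechet_subgradient_within UNIV g x (blinfun_apply w)" for x w
      proof (rule d(2))
        show "x \<in> ball xbar d" using that(1) by (simp add: d'_def)
        have "x \<in> B" using that(1) by (simp add: d'_def B_def)
        then show "w \<in> frechet_subdiff f x" 
          using frechet_subdiff_iff[where f = f and g = g, OF B(1) _ fg] that(2) by blast
      qed
      show ?thesis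
      proof (rule asplund_strict_estimate[OF assms(1) lip l(1) _ d' near])
        show "e / 3 > 0" using \<open>e > 0\<close> by simp
        fix \<rho> :: real
        assume "\<rho> > 0" "\<And>x y. x \<in> ball xbar \<rho> \<Longrightarrow> y \<in> ball xbar \<rho> \<Longrightarrow>
          \<bar>g x - g y - blinfun_apply v (x - y)\<bar> \<le> 3 * (e / 3) * norm (x - y)"
        then show ?thesis by (intro exI[of _ \<rho>]) simp
      qed
    qed
    then have "\<exists>v. \<forall>e>0. \<exists>d>0. \<forall>x\<in>ball xbar d. \<forall>y\<in>ball xbar d.
        \<bar>g x - g y - blinfun_apply v (x - y)\<bar> \<le> e * norm (x - y)"
      by (intro exI[of _ v] allI impI)
    then show "strictly_differentiable_at f xbar"
      by (simp only: strictly_differentiable_at_iff[where f = f and g = g, OF B fg])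
  next
    assume "strictly_differentiable_at f xbar"
    then obtain v where v: "\<And>e. e > 0 \<Longrightarrow> \<exists>d>0. \<forall>x\<in>ball xbar d. \<forall>y\<in>ball xbar d.
        \<bar>f0 x - f0 y - blinfun_apply v (x - y)\<bar> \<le> e * norm (x - y)"
      using strictly_differentiable_at_iff[of "ball xbar r" xbar f f0] r(1) f0 by auto
    show "locally_lipschitz_around f xbar \<and> strongly_continuous_at (frechet_subdiff f) xbar"
    proof
      \<comment> \<open>The estimate with \<open>e = 1\<close> makes \<open>norm v + 1\<close> a
        Lipschitz constant; halving the radius fits a closed ball into both open balls.\<close>
      obtain d where d: "d > 0" "\<And>x y. x \<in> ball xbar d \<Longrightarrow> y \<in> ball xbar d \<Longrightarrow>
          \<bar>f0 x - f0 y - blinfun_apply v (x - y)\<bar> \<le> 1 * norm (x - y)"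
        using v[of 1] by auto
      define \<delta> where "\<delta> = min d r / 2"
      have \<delta>: "\<delta> > 0" "\<delta> < d" "\<delta> < r" using d(1) r(1) by (auto simp: \<delta>_def)
      have "\<bar>f x - f w\<bar> \<le> ereal ((norm v + 1) * norm (x - w))" if "x \<in> cball xbar \<delta>" "w \<in> cball xbar \<delta>" for x w
      proof -
        have "x \<in> ball xbar d" "w \<in> ball xbar d" and xr: "x \<in> ball xbar r" "w \<in> ball xbar r" using that \<delta> by auto
        then have "\<bar>f0 x - f0 w - blinfun_apply v (x - w)\<bar> \<le> norm (x - w)" using d(2) by fastforce
        moreover have "\<bar>blinfun_apply v (x - w)\<bar> \<le> norm v * norm (x - w)" using norm_blinfun[of v "x - w"] by simp
        ultimately have "\<bar>f0 x - f0 w\<bar> \<le> (norm v + 1) * norm (x - w)" unfolding distrib_right by linarith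
        then show ?thesis using f0 xr by simp
      qed
      then show "locally_lipschitz_around f xbar"
        unfolding locally_lipschitz_around_def using \<delta>(1) by (intro exI[of _ "norm v + 1"] exI[of _ \<delta>]) auto
    next
      show "strongly_continuous_at (frechet_subdiff f) xbar"
        unfolding strongly_continuous_at_def
      proof (intro exI[of _ v] allI impI)
        fix x :: "nat \<Rightarrow> 'a" and w
        assume xw: "x \<longlonglongrightarrow> xbar \<and> (\<forall>k. w k \<in> frechet_subdiff f (x k))"
        show "(\<lambda>k. norm (w k - v)) \<longlonglongrightarrow> 0"
        proof (rule tendstoI)
          fix e :: real assume "e > 0"
          \<comment> \<open>Comparing subgradients doubles the error, and the result must stay
            strictly below \<open>e\<close>; hence \<open>e / 3\<close>.\<close>
          then obtain d where d: "d > 0" "\<And>x y. x \<in> ball xbar d \<Longrightarrow> y \<in> ball xbar d \<Longrightarrow>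
              \<bar>f0 x - f0 y - blinfun_apply v (x - y)\<bar> \<le> e / 3 * norm (x - y)"
            using v[of "e / 3"] by auto
          have "\<forall>\<^sub>F k in sequentially. x k \<in> ball xbar (min d r)"
            using xw r(1) d(1) by (intro topological_tendstoD[where S = "ball xbar (min d r)"]) auto
          then show "\<forall>\<^sub>F k in sequentially. dist (norm (w k - v)) 0 < e"
          proof eventually_elim
            case (elim k)
            then have mem: "x k \<in> ball xbar d" "x k \<in> ball xbar r" by auto
            have "frechet_subgradient_within UNIV f0 (x k) (blinfun_apply (w k))"
              
              using xw frechet_subdiff_iff[where f = f and g = f0, OF open_ball mem(2) f0] by blast
            then have "norm (w k - v) \<le> 2 * (e / 3)"
              using \<open>e > 0\<close> mem(1) d(2) by (intro subgradient_close_if_strict_estimate[where x = "x k" and a = xbar and d = d]) auto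
            then show ?case using \<open>e > 0\<close> by simp
          qed
        qed
      qed
    qed
  qed
qed

end
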